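(* Let $m\in\mathbb{C}$ and let $u\in C^2(\mathbb{H}^+)$ (complex valued) be such that $L_mu=0$ on $\mathbb{H}^+$ and $\lim_{\partial\mathbb{H}^+}u=0$. Then $u\equiv0$ on $\mathbb{H}^+$.
   Context: $\mathbb{H}^+=\{(x,y)\in\mathbb{R}^2: x>0\}$. For $m\in\mathbb{C}$, $L_mu=\Delta u+\frac{m}{x}\frac{\partial u}{\partial x}$. For a function $u$ on $\mathbb{H}^+$, $\lim_{\partial\mathbb{H}^+}u=0$ means: for every $\varepsilon>0$ there is $N\in\mathbb{N}$ such that for all $n\ge N$ and all $(x,y)\in\mathbb{H}^+$, if $x\le\frac1n$ or $\|(x,y)\|\ge n$, then $|u(x,y)|\le\varepsilon$. *)

theory Defs
  imports "HOL-Analysis.Analysis"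
begin

definition half_plane :: "(real \<times> real) set" where
  "half_plane = {(x, y). x > 0}"

definition partial_x :: "(real \<times> real \<Rightarrow> complex) \<Rightarrow> real \<times> real \<Rightarrow> complex" where
  "partial_x u = (\<lambda>(x, y). vector_derivative (\<lambda>t. u (t, y)) (at x))"

definition partial_y :: "(real \<times> real \<Rightarrow> complex) \<Rightarrow> real \<times> real \<Rightarrow> complex" where
  "partial_y u = (\<lambda>(x, y). vector_derivative (\<lambda>t. u (x, t)) (at y))"

definition has_partials_on :: "(real \<times> real \<Rightarrow> complex) \<Rightarrow> (real \<times> real) set \<Rightarrow> bool" where
  "has_partials_on u S \<longleftrightarrow>
    (\<forall>(x, y)\<in>S. (\<lambda>t. u (t, y)) differentiable at x \<and> (\<lambda>t. u (x, t)) differentiable at y)"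

text \<open>
  Classical \<open>C\<^sup>k\<close> regularity on an open set \<open>S\<close>: all partial derivatives of order at most \<open>k\<close>,
  mixed ones included, exist and are continuous on \<open>S\<close>. Since \<open>S\<close> is open, values of \<open>u\<close> outside
  \<open>S\<close> are irrelevant.
\<close>

primrec Ck_on :: "nat \<Rightarrow> (real \<times> real \<Rightarrow> complex) \<Rightarrow> (real \<times> real) set \<Rightarrow> bool" where
  "Ck_on 0 u S \<longleftrightarrow> continuous_on S u"
| "Ck_on (Suc k) u S \<longleftrightarrow> continuous_on S u \<and> has_partials_on u S
      \<and> Ck_on k (partial_x u) S \<and> Ck_on k (partial_y u) S"

definition laplacian :: "(real \<times> real \<Rightarrow> complex) \<Rightarrow> real \<times> real \<Rightarrow> complex" where
  "laplacian u p = partial_x (partial_x u) p + partial_y (partial_y u) p"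

definition L_op :: "complex \<Rightarrow> (real \<times> real \<Rightarrow> complex) \<Rightarrow> real \<times> real \<Rightarrow> complex" where
  "L_op m u p = laplacian u p + m / of_real (fst p) * partial_x u p"

text \<open>
  Restricting to \<open>N \<ge> 1\<close> only avoids the convention \<open>1 / 0 = 0\<close>; the norm on \<^typ>\<open>real \<times> real\<close> is
  the Euclidean one.
\<close>

definition vanishes_at_boundary :: "(real \<times> real \<Rightarrow> complex) \<Rightarrow> bool" where
  "vanishes_at_boundary u \<longleftrightarrow>
    (\<forall>\<epsilon>>0. \<exists>N::nat. N \<ge> 1 \<and> (\<forall>n\<ge>N. \<forall>(x, y)\<in>half_plane.
        x \<le> 1 / real n \<or> norm (x, y) \<ge> real n \<longrightarrow> norm (u (x, y)) \<le> \<epsilon>))"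

end

theory Submission
  imports Defs
begin

text \<open>
  In the coordinates \<open>x = exp t * cos h\<close>, \<open>y = exp t * sin h\<close> the equation \<open>L\<^sub>m u = 0\<close> reads
  \<open>u\<^bsub>tt\<^esub> + m u\<^bsub>t\<^esub> + u\<^bsub>hh\<^esub> - m tan h u\<^bsub>h\<^esub> = 0\<close>. Integrating it against \<open>cos h sin\<^sup>k h\<close> on half circles,
  the moments \<open>J\<^sub>k(t) = \<integral> u cos h sin\<^sup>k h dh\<close> satisfy, with \<open>n = k + 1\<close>,
  \<open>J\<^sub>k'' + m J\<^sub>k' + n (m - n) J\<^sub>k + k (k - 1) J\<^bsub>k-2\<^esub> = 0\<close>.
  By induction the last term vanishes, so \<open>J\<^sub>k\<close> solves a linear equation with constant coefficients,
  whose characteristic roots are \<open>-n\<close> and \<open>n - m\<close>, and it tends to 0 at both ends because \<open>u\<close> vanishes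
  at the boundary; hence \<open>J\<^sub>k = 0\<close>. Since polynomials in \<open>sin h\<close> are dense, \<open>u = 0\<close>.

  Nothing is known about the gradient of \<open>u\<close> near \<open>x = 0\<close>, so \<open>cos h\<close> is first replaced by
  \<open>cos h (1 - d / cos h)\<^sup>2\<close> on \<open>cos h \<ge> d\<close>, which vanishes to second order at the ends. The resulting
  error in the equation is bounded by a multiple of \<open>\<integral> |u| d / cos\<^sup>2 h dh\<close>: this kernel has bounded mass
  and concentrates at the boundary as \<open>d \<rightarrow> 0\<close>, so the error tends to 0 uniformly in \<open>t\<close>.
\<close>

subsection \<open>Logarithmic polar coordinates\<close>

text \<open>Existence of both partial derivatives and continuity of the \<open>y\<close>-derivative
  give a total derivative, which the chain rule along \<open>log_polar\<close> requires.\<close>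

lemma C1_has_derivative:
  assumes C1: "Ck_on (Suc k) f half_plane" and x: "x > 0"
  shows "(f has_derivative (\<lambda>(h, k). h *\<^sub>R partial_x f (x, y) + k *\<^sub>R partial_y f (x, y))) (at (x, y))"
proof -
  have hp: "half_plane = {0<..} \<times> (UNIV :: real set)"
    by (auto simp: half_plane_def)
  have op: "open half_plane"
    unfolding hp by (intro open_Times) auto
  have fx: "((\<lambda>a. f (a, b)) has_vector_derivative partial_x f (a, b)) (at a)"
   and fy: "((\<lambda>b. f (a, b)) has_vector_derivative partial_y f (a, b)) (at b)" if "a > 0" for a b
    using C1 that
    by (auto simp: has_partials_on_def half_plane_def partial_x_def partial_y_def
        vector_derivative_works)
  have "Ck_on k (partial_y f) half_plane"
    using C1 by simp
  then have cont: "continuous_on half_plane (partial_y f)"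
    by (cases k) auto
  have "((\<lambda>(a, b). f (a, b)) has_derivative
      (\<lambda>(h, k). h *\<^sub>R partial_x f (x, y) + blinfun_apply (blinfun_scaleR_left (partial_y f (x, y))) k))
      (at (x, y) within {0<..} \<times> UNIV)"
  proof (rule has_derivative_partialsI[where fy = "\<lambda>a b. blinfun_scaleR_left (partial_y f (a, b))"])
    show "((\<lambda>a. f (a, y)) has_derivative (\<lambda>h. h *\<^sub>R partial_x f (x, y))) (at x within {0<..})"
      using fx[OF x] by (simp add: has_vector_derivative_def has_derivative_at_withinI)
    show "((\<lambda>b. f (a, b)) has_derivative blinfun_apply (blinfun_scaleR_left (partial_y f (a, b))))
        (at b within UNIV)" if "a \<in> {0<..}" for a b
      using fy[of a b] that by (simp add: has_vector_derivative_def)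
    have "continuous (at (x, y) within half_plane) (partial_y f)"
      using cont x by (auto simp: continuous_on_eq_continuous_within half_plane_def)
    then show "continuous (at (x, y) within {0<..} \<times> UNIV)
        (\<lambda>(a, b). blinfun_scaleR_left (partial_y f (a, b)))"
      unfolding hp split_def prod.collapse
      by (rule bounded_linear.continuous[OF bounded_linear_blinfun_scaleR_left])
  qed auto
  moreover have "at (x, y) within half_plane = at (x, y)"
    using op x by (intro at_within_open) (auto simp: half_plane_def)
  ultimately show ?thesis
    by (simp add: hp)
qed

text \<open>Taking the logarithm of the radius turns dilations into translations in
  \<open>t\<close>, so the transformed equation has coefficients that do not depend on
  \<open>t\<close>.\<close>

definition log_polar :: "real \<Rightarrow> real \<Rightarrow> real \<times> real" where
  "log_polar t h = (exp t * cos h, exp t * sin h)"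

lemma log_polar_in_half_plane: "cos h > 0 \<Longrightarrow> log_polar t h \<in> half_plane"
  by (simp add: log_polar_def half_plane_def)

lemma fst_log_polar [simp]: "fst (log_polar t h) = exp t * cos h"
  by (simp add: log_polar_def)

lemma norm_log_polar [simp]: "norm (log_polar t h) = exp t"
proof -
  have "(exp t * cos h)\<^sup>2 + (exp t * sin h)\<^sup>2 = (exp t)\<^sup>2 * ((cos h)\<^sup>2 + (sin h)\<^sup>2)"
    by (simp only: power_mult_distrib ring_distribs)
  then show ?thesis
    by (simp add: log_polar_def norm_Pair)
qed

lemma continuous_log_polar: "continuous_on S (\<lambda>(t, h). log_polar t h)"
  unfolding log_polar_def split_def by (intro continuous_intros)

lemma has_vector_derivative_log_polar:
  assumes "Ck_on (Suc k) f half_plane" "cos h > 0"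
  shows "((\<lambda>t. f (log_polar t h)) has_vector_derivative
           (exp t * cos h) *\<^sub>R partial_x f (log_polar t h)
           + (exp t * sin h) *\<^sub>R partial_y f (log_polar t h)) (at t)" (is ?T)
    and "((\<lambda>h. f (log_polar t h)) has_vector_derivative
           - (exp t * sin h) *\<^sub>R partial_x f (log_polar t h)
           + (exp t * cos h) *\<^sub>R partial_y f (log_polar t h)) (at h)" (is ?H)
proof -
  let ?D = "\<lambda>(a, b). a *\<^sub>R partial_x f (log_polar t h) + b *\<^sub>R partial_y f (log_polar t h)"
  have D: "(f has_derivative ?D) (at (log_polar t h))"
    using C1_has_derivative[OF assms(1), of "exp t * cos h" "exp t * sin h"] assms(2)
    by (simp add: log_polar_def)
  have "((\<lambda>t. log_polar t h) has_derivative (\<lambda>a. (a * (exp t * cos h), a * (exp t * sin h)))) (at t)"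
    unfolding log_polar_def by (auto intro!: derivative_eq_intros)
  from has_derivative_compose[OF this D] show ?T
    by (simp add: has_vector_derivative_def scaleR_add_right)
  have "((\<lambda>h. log_polar t h) has_derivative (\<lambda>a. (a * - (exp t * sin h), a * (exp t * cos h)))) (at h)"
    unfolding log_polar_def by (auto intro!: derivative_eq_intros)
  from has_derivative_compose[OF this D] show ?H
    by (simp add: has_vector_derivative_def scaleR_add_right scaleR_diff_right)
qed

lemma continuous_on_compose_log_polar:
  assumes "continuous_on half_plane f" "\<And>t h. (t, h) \<in> S \<Longrightarrow> cos h > 0"
  shows "continuous_on S (\<lambda>(t, h). f (log_polar t h))"
proof -
  have "continuous_on S (\<lambda>p. f ((\<lambda>(t, h). log_polar t h) p))"
    by (rule continuous_on_compose2[OF assms(1) continuous_log_polar])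
      (use assms(2) log_polar_in_half_plane in \<open>force simp del: fst_log_polar\<close>)
  then show ?thesis
    by (simp add: split_def)
qed

section \<open>Integrating the equation against a weight in the angle\<close>

text \<open>Differentiation under the integral produces the weighted means of \<open>Ut\<close> and
  \<open>Utt\<close>; the equation trades them for \<open>h\<close>-derivatives of \<open>U\<close>,
  and integration by parts moves these onto \<open>w\<close>. The double zeros of \<open>w\<close>
  at \<open>c\<close> and \<open>-c\<close> remove all boundary terms.\<close>

lemma weighted_mean_ODE:
  fixes U Ut Utt Uh Uhh :: "real \<Rightarrow> real \<Rightarrow> complex" and w w1 w2 v1 :: "real \<Rightarrow> real"
  assumes c: "c > 0"
    and Ut: "\<And>t h. h \<in> {-c..c} \<Longrightarrow> ((\<lambda>t. U t h) has_vector_derivative Ut t h) (at t)"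
    and Utt: "\<And>t h. h \<in> {-c..c} \<Longrightarrow> ((\<lambda>t. Ut t h) has_vector_derivative Utt t h) (at t)"
    and Uh: "\<And>t h. h \<in> {-c..c} \<Longrightarrow> (U t has_vector_derivative Uh t h) (at h)"
    and Uhh: "\<And>t h. h \<in> {-c..c} \<Longrightarrow> (Uh t has_vector_derivative Uhh t h) (at h)"
    and cont: "continuous_on (UNIV \<times> {-c..c}) (\<lambda>(t, h). U t h)"
      "continuous_on (UNIV \<times> {-c..c}) (\<lambda>(t, h). Ut t h)"
      "continuous_on (UNIV \<times> {-c..c}) (\<lambda>(t, h). Utt t h)"
    and pde: "\<And>t h. h \<in> {-c..c} \<Longrightarrow>
        Utt t h + m * Ut t h + Uhh t h - m * of_real (tan h) * Uh t h = 0"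
    and w: "\<And>h. h \<in> {-c..c} \<Longrightarrow> (w has_real_derivative w1 h) (at h)"
    and w1: "\<And>h. h \<in> {-c..c} \<Longrightarrow> (w1 has_real_derivative w2 h) (at h)"
    and v: "\<And>h. h \<in> {-c..c} \<Longrightarrow> ((\<lambda>h. tan h * w h) has_real_derivative v1 h) (at h)"
    and ends: "w c = 0" "w (-c) = 0" "w1 c = 0" "w1 (-c) = 0"
  obtains A1 A2 where
    "\<And>t. ((\<lambda>t. integral {-c..c} (\<lambda>h. U t h * of_real (w h))) has_vector_derivative A1 t) (at t)"
    "\<And>t. (A1 has_vector_derivative A2 t) (at t)"
    "\<And>t. ((\<lambda>h. U t h * (of_real (w2 h) + m * of_real (v1 h))) has_integral
            - (A2 t + m * A1 t)) {-c..c}"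
proof -
  have cw: "continuous_on {-c..c} w"
    using w by (meson DERIV_isCont continuous_at_imp_continuous_on)
  have slice: "continuous_on {-c..c} (\<lambda>h. F t h * of_real (w h))"
    if "continuous_on (UNIV \<times> {-c..c}) (\<lambda>(t, h). F t h)" for F :: "real \<Rightarrow> real \<Rightarrow> complex" and t
  proof -
    have "continuous_on {-c..c} (\<lambda>h. (\<lambda>(t, h). F t h) (t, h))"
      by (rule continuous_on_compose2[OF that]) (auto intro!: continuous_intros)
    with cw show ?thesis
      by (auto intro!: continuous_intros)
  qed
  have joint: "continuous_on (UNIV \<times> {-c..c}) (\<lambda>(t, h). F t h * of_real (w h))"
    if "continuous_on (UNIV \<times> {-c..c}) (\<lambda>(t, h). F t h)" for F :: "real \<Rightarrow> real \<Rightarrow> complex"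
  proof -
    have "continuous_on (UNIV \<times> {-c..c}) (\<lambda>p :: real \<times> real. w (snd p))"
      by (rule continuous_on_compose2[OF cw]) (auto intro!: continuous_intros)
    with that show ?thesis
      by (auto simp: split_def intro!: continuous_intros)
  qed
  have leib: "((\<lambda>t. integral {-c..c} (\<lambda>h. F t h * of_real (w h))) has_vector_derivative
      integral {-c..c} (\<lambda>h. F' t h * of_real (w h))) (at t)"
    if "\<And>t h. h \<in> {-c..c} \<Longrightarrow> ((\<lambda>t. F t h) has_vector_derivative F' t h) (at t)"
      and F: "continuous_on (UNIV \<times> {-c..c}) (\<lambda>(t, h). F t h)"
      and F': "continuous_on (UNIV \<times> {-c..c}) (\<lambda>(t, h). F' t h)"
    for F F' :: "real \<Rightarrow> real \<Rightarrow> complex" and t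
    unfolding cbox_interval[symmetric]
  proof (rule leibniz_rule_vector_derivative)
    show "(\<lambda>h. F t h * of_real (w h)) integrable_on cbox (-c) c" for t
      using slice[OF F] integrable_continuous by (simp add: integrable_continuous_interval)
  qed (use that(1) joint[OF F'] in \<open>auto intro!: has_vector_derivative_mult_left\<close>)
  define A1 A2 where "A1 = (\<lambda>t. integral {-c..c} (\<lambda>h. Ut t h * of_real (w h)))"
    and "A2 = (\<lambda>t. integral {-c..c} (\<lambda>h. Utt t h * of_real (w h)))"
  have "((\<lambda>h. U t h * (of_real (w2 h) + m * of_real (v1 h))) has_integral - (A2 t + m * A1 t)) {-c..c}"
    for t
  proof -
    \<comment> \<open>\<open>F\<close> collects the boundary terms of all integrations by parts; the
      products \<open>Uh * w1\<close> cancel in its derivative \<open>F'\<close>.\<close>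
    define F where "F = (\<lambda>h. Uh t h * of_real (w h) - U t h * of_real (w1 h)
        - m * (U t h * of_real (tan h * w h)))"
    define F' where "F' = (\<lambda>h. (Uhh t h - m * of_real (tan h) * Uh t h) * of_real (w h)
        - U t h * (of_real (w2 h) + m * of_real (v1 h)))"
    have "(F has_vector_derivative F' h) (at h within {-c..c})" if h: "h \<in> {-c..c}" for h
    proof -
      note d = has_vector_derivative_mult[OF Uh[OF h] has_vector_derivative_of_real[OF w1[OF h]]]
        has_vector_derivative_mult[OF Uhh[OF h] has_vector_derivative_of_real[OF w[OF h]]]
        has_vector_derivative_mult_right[OF
          has_vector_derivative_mult[OF Uh[OF h] has_vector_derivative_of_real[OF v[OF h]]], of m]
      from has_vector_derivative_diff[OF has_vector_derivative_diff[OF d(2) d(1)] d(3)]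
      have "(F has_vector_derivative F' h) (at h)"
        unfolding F_def F'_def by (rule has_vector_derivative_eq_rhs) (simp add: algebra_simps)
      then show ?thesis
        by (rule has_vector_derivative_at_within)
    qed
    then have "(F' has_integral F c - F (-c)) {-c..c}"
      using c by (intro fundamental_theorem_of_calculus) auto
    moreover have "F c - F (-c) = 0"
      by (simp add: F_def ends)
    ultimately have F': "(F' has_integral 0) {-c..c}"
      by simp
    have int: "((\<lambda>h. Ut t h * of_real (w h)) has_integral A1 t) {-c..c}"
        "((\<lambda>h. Utt t h * of_real (w h)) has_integral A2 t) {-c..c}"
      unfolding A1_def A2_def using cont
      by (auto intro!: integrable_integral integrable_continuous_interval slice)
    have "((\<lambda>h. - (Utt t h * of_real (w h) + m * (Ut t h * of_real (w h)) + F' h)) has_integral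
        - (A2 t + m * A1 t + 0)) {-c..c}"
      by (intro has_integral_neg has_integral_add has_integral_mult_right int F')
    moreover have "- (Utt t h * of_real (w h) + m * (Ut t h * of_real (w h)) + F' h)
        = U t h * (of_real (w2 h) + m * of_real (v1 h))" if "h \<in> {-c..c}" for h
    proof -
      have eq: "Uhh t h - m * of_real (tan h) * Uh t h = - (Utt t h + m * Ut t h)"
        using pde[OF that, of t] by (simp add: algebra_simps eq_neg_iff_add_eq_0)
      show ?thesis
        unfolding F'_def eq by (simp add: algebra_simps)
    qed
    ultimately show ?thesis
      using has_integral_cong[of "{-c..c}"] by (metis (no_types, lifting) add_0_right)
  qed
  moreover have "((\<lambda>t. integral {-c..c} (\<lambda>h. U t h * of_real (w h))) has_vector_derivative A1 t) (at t)"
    "(A1 has_vector_derivative A2 t) (at t)" for t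
    unfolding A1_def A2_def by (auto intro!: leib Ut Utt cont)
  ultimately show ?thesis
    using that by blast
qed

subsection \<open>Approximate solutions of second-order equations\<close>

text \<open>With the integrating factor in \<open>H\<close>, the derivative on
  \<open>{t..t+1}\<close> is at most \<open>exp (norm a) * \<delta>\<close>, and the mean value
  inequality applies. Multiplying back by \<open>exp a\<close> costs the second factor
  \<open>exp (norm a)\<close>.\<close>

lemma first_order_step_bound:
  fixes G G' :: "real \<Rightarrow> complex"
  assumes G: "\<And>t. (G has_vector_derivative G' t) (at t)"
    and bound: "\<And>t. norm (G' t - a * G t) \<le> \<delta>"
  shows "norm (G (t + 1) - exp a * G t) \<le> exp (2 * norm a) * \<delta>"
proof -
  define H where "H = (\<lambda>s. exp (- (a * of_real (s - t))) * G s)"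
  have d: "(H has_vector_derivative exp (- (a * of_real (s - t))) * (G' s - a * G s)) (at s)" for s
  proof -
    have "((\<lambda>s. exp (- (a * of_real (s - t)))) has_vector_derivative
        exp (- (a * of_real (s - t))) * - a) (at s)"
    proof -
      have "((\<lambda>s. - (a * of_real (s - t))) has_vector_derivative - (a * of_real 1)) (at s)"
        by (intro has_vector_derivative_minus has_vector_derivative_mult_right
            has_vector_derivative_of_real) (auto intro!: derivative_eq_intros)
      from field_vector_diff_chain_at[OF this DERIV_exp] show ?thesis
        by (simp add: o_def mult.commute)
    qed
    from has_vector_derivative_mult[OF this G] show ?thesis
      unfolding H_def by (rule has_vector_derivative_eq_rhs) (simp add: algebra_simps)
  qed
  have "norm (H (t + 1) - H t) \<le> (exp (norm a) * \<delta>) * norm (t + 1 - t)"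
  proof (rule differentiable_bound[where S = "{t..t+1}" and
        f' = "\<lambda>s k. k *\<^sub>R (exp (- (a * of_real (s - t))) * (G' s - a * G s))"])
    show "(H has_derivative (\<lambda>k. k *\<^sub>R (exp (- (a * of_real (s - t))) * (G' s - a * G s))))
        (at s within {t..t+1})" for s
      using d[of s] by (simp add: has_vector_derivative_def has_derivative_at_withinI)
    show "onorm (\<lambda>k. k *\<^sub>R (exp (- (a * of_real (s - t))) * (G' s - a * G s))) \<le> exp (norm a) * \<delta>"
      if "s \<in> {t..t+1}" for s
    proof (rule onorm_le)
      fix k :: real
      have "norm (exp (- (a * of_real (s - t)))) \<le> exp (norm (a * of_real (s - t)))"
        using norm_exp[of "- (a * of_real (s - t))"] by simp
      also have "\<dots> \<le> exp (norm a)"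
        using that by (auto simp: norm_mult simp flip: of_real_diff intro!: mult_left_le)
      finally have "norm (exp (- (a * of_real (s - t))) * (G' s - a * G s)) \<le> exp (norm a) * \<delta>"
        unfolding norm_mult using bound by (intro mult_mono) auto
      then show "norm (k *\<^sub>R (exp (- (a * of_real (s - t))) * (G' s - a * G s)))
          \<le> exp (norm a) * \<delta> * norm k"
        by (simp add: mult_left_mono mult.commute)
    qed
  qed auto
  then have *: "norm (exp (- a) * G (t + 1) - G t) \<le> exp (norm a) * \<delta>"
    by (simp add: H_def)
  have "G (t + 1) - exp a * G t = exp a * (exp (- a) * G (t + 1) - G t)"
    by (simp add: exp_minus field_simps)
  then have "norm (G (t + 1) - exp a * G t) \<le> exp (norm a) * (exp (norm a) * \<delta>)"
    unfolding norm_mult using * norm_exp[of a] by (auto simp: norm_mult intro!: mult_mono)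
  then show ?thesis
    by (simp add: mult.assoc[symmetric] flip: exp_add)
qed

text \<open>The operator factors into two first-order ones. \<open>G = F1 - b * F\<close> satisfies
  an approximate equation with coefficient \<open>a\<close>, so its step defect is small; this
  defect is exactly \<open>T' - b * T\<close> for the step defect \<open>T\<close> of
  \<open>F\<close>, and the first-order bound applies again.\<close>

lemma second_order_step_bound:
  fixes F F1 F2 :: "real \<Rightarrow> complex"
  assumes F: "\<And>t. (F has_vector_derivative F1 t) (at t)"
    and F1: "\<And>t. (F1 has_vector_derivative F2 t) (at t)"
    and bound: "\<And>t. norm (F2 t - (a + b) * F1 t + a * b * F t) \<le> \<delta>"
  shows "norm ((F (t + 2) - exp a * F (t + 1)) - exp b * (F (t + 1) - exp a * F t))
           \<le> exp (2 * norm b) * (exp (2 * norm a) * \<delta>)"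
proof -
  define G where "G = (\<lambda>t. F1 t - b * F t)"
  have "(G has_vector_derivative F2 t - b * F1 t) (at t)" for t
    unfolding G_def by (intro has_vector_derivative_diff has_vector_derivative_mult_right F F1)
  moreover have "norm (F2 t - b * F1 t - a * G t) \<le> \<delta>" for t
    using bound[of t] by (simp add: G_def algebra_simps)
  ultimately have G: "norm (G (t + 1) - exp a * G t) \<le> exp (2 * norm a) * \<delta>" for t
    by (rule first_order_step_bound)
  define T where "T = (\<lambda>t. F (t + 1) - exp a * F t)"
  have shift: "((\<lambda>t. F (t + 1)) has_vector_derivative F1 (t + 1)) (at t)" for t
  proof -
    have "((\<lambda>t. t + 1) has_vector_derivative 1) (at t)"
      by (auto intro!: derivative_eq_intros simp flip: has_real_derivative_iff_has_vector_derivative)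
    from vector_diff_chain_at[OF this F] show ?thesis
      by (simp add: o_def)
  qed
  have "norm (T (t + 1) - exp b * T t) \<le> exp (2 * norm b) * (exp (2 * norm a) * \<delta>)"
  proof (rule first_order_step_bound)
    show "(T has_vector_derivative F1 (t + 1) - exp a * F1 t) (at t)" for t
      unfolding T_def by (intro has_vector_derivative_diff has_vector_derivative_mult_right F shift)
    show "norm (F1 (t + 1) - exp a * F1 t - b * T t) \<le> exp (2 * norm a) * \<delta>" for t
      using G[of t] by (simp add: G_def T_def algebra_simps)
  qed
  then show ?thesis
    by (simp add: T_def add.assoc)
qed

text \<open>A nonzero value is multiplied by powers of \<open>q\<close> along the steps. If
  \<open>norm q \<ge> 1\<close> its size does not decrease forwards, otherwise it does not decrease
  backwards; either way one of the two limits is contradicted.\<close>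

lemma geometric_zero:
  fixes G :: "real \<Rightarrow> complex"
  assumes rec: "\<And>t. G (t + 1) = q * G t" and q: "q \<noteq> 0"
    and top: "(G \<longlongrightarrow> 0) at_top" and bot: "(G \<longlongrightarrow> 0) at_bot"
  shows "G t = 0"
proof (rule ccontr)
  assume nz: "G t \<noteq> 0"
  have fwd: "G (s + real n) = q ^ n * G s" for s n
  proof (induction n)
    case (Suc n)
    then show ?case
      using rec[of "s + real n"] by (simp add: ac_simps)
  qed simp
  show False
  proof (cases "norm q \<ge> 1")
    case True
    have "((\<lambda>n. G (t + real n)) \<longlongrightarrow> 0) sequentially"
      by (rule filterlim_compose[OF top])
        (intro filterlim_tendsto_add_at_top[OF tendsto_const] filterlim_real_sequentially)
    then have "eventually (\<lambda>n. norm (G (t + real n)) < norm (G t)) sequentially"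
      using nz by (intro order_tendstoD(2)[OF tendsto_norm_zero]) auto
    then obtain n where "norm (G (t + real n)) < norm (G t)"
      by (auto simp: eventually_sequentially)
    moreover have "norm (G (t + real n)) \<ge> 1 * norm (G t)"
      unfolding fwd norm_mult norm_power using True by (intro mult_right_mono one_le_power) auto
    ultimately show False by simp
  next
    case False
    have "((\<lambda>n. G (t - real n)) \<longlongrightarrow> 0) sequentially"
    proof (rule filterlim_compose[OF bot])
      have "filterlim (\<lambda>n. - t + real n) at_top sequentially"
        by (intro filterlim_tendsto_add_at_top[OF tendsto_const] filterlim_real_sequentially)
      then show "filterlim (\<lambda>n. t - real n) at_bot sequentially"
        by (simp add: filterlim_uminus_at_top)
    qed
    then have "eventually (\<lambda>n. norm (G (t - real n)) < norm (G t)) sequentially"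
      using nz by (intro order_tendstoD(2)[OF tendsto_norm_zero]) auto
    then obtain n where n: "norm (G (t - real n)) < norm (G t)"
      by (auto simp: eventually_sequentially)
    have "norm (G t) = norm q ^ n * norm (G (t - real n))"
      using fwd[of "t - real n" n] by (simp add: norm_mult norm_power)
    also have "\<dots> \<le> 1 * norm (G (t - real n))"
      using False by (intro mult_right_mono power_le_one) auto
    finally show False using n by simp
  qed
qed

lemma shifted_tendsto_0:
  fixes G :: "real \<Rightarrow> complex"
  assumes "(G \<longlongrightarrow> 0) at_top" "(G \<longlongrightarrow> 0) at_bot"
  shows "((\<lambda>t. G (t + 1) - q * G t) \<longlongrightarrow> 0) at_top"
    and "((\<lambda>t. G (t + 1) - q * G t) \<longlongrightarrow> 0) at_bot"
proof -
  have "filterlim (\<lambda>t::real. 1 + t) at_top at_top"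
    by (intro filterlim_tendsto_add_at_top[OF tendsto_const] filterlim_ident)
  then have "((\<lambda>t. G (1 + t)) \<longlongrightarrow> 0) at_top"
    by (rule filterlim_compose[OF assms(1)])
  from tendsto_diff[OF this tendsto_mult_right_zero[OF assms(1), of q]]
  show "((\<lambda>t. G (t + 1) - q * G t) \<longlongrightarrow> 0) at_top"
    by (simp add: add.commute)
  have "filterlim (\<lambda>t::real. 1 + t) at_bot at_bot"
    unfolding filterlim_at_bot eventually_at_bot_linorder
    by (metis add.commute le_diff_eq)
  then have "((\<lambda>t. G (1 + t)) \<longlongrightarrow> 0) at_bot"
    by (rule filterlim_compose[OF assms(2)])
  from tendsto_diff[OF this tendsto_mult_right_zero[OF assms(2), of q]]
  show "((\<lambda>t. G (t + 1) - q * G t) \<longlongrightarrow> 0) at_bot"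
    by (simp add: add.commute)
qed

text \<open>
  The limit \<open>J\<close> need not be known to be differentiable: the differential equation is used only through
  the recurrence with step 1 that it implies, and a recurrence survives uniform limits.
\<close>

lemma decaying_limit_zero:
  fixes J :: "real \<Rightarrow> complex" and a b :: complex
  assumes approx: "\<And>\<epsilon>. \<epsilon> > 0 \<Longrightarrow> \<exists>F F1 F2.
      (\<forall>t. (F has_vector_derivative F1 t) (at t) \<and> (F1 has_vector_derivative F2 t) (at t) \<and>
        norm (F2 t - (a + b) * F1 t + a * b * F t) \<le> \<epsilon> \<and> norm (F t - J t) \<le> \<epsilon>)"
    and top: "(J \<longlongrightarrow> 0) at_top" and bot: "(J \<longlongrightarrow> 0) at_bot"
  shows "J t = 0"
proof -
  define T where "T = (\<lambda>t. J (t + 1) - exp a * J t)"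
  \<comment> \<open>The first summand bounds the effect of the residual of the approximate solution
    \<open>F\<close>; the second bounds the effect of replacing \<open>F\<close> by \<open>J\<close>
    at \<open>t\<close>, \<open>t + 1\<close> and \<open>t + 2\<close>.\<close>
  define K where "K = exp (2 * norm b) * exp (2 * norm a)
    + (1 + norm (exp a) + norm (exp b) * (1 + norm (exp a)))"
  have K: "K > 0"
    unfolding K_def by (intro add_pos_nonneg) auto
  have "T (t + 1) = exp b * T t" for t
  proof -
    have "norm (T (t + 1) - exp b * T t) \<le> \<epsilon>" if "\<epsilon> > 0" for \<epsilon>
    proof -
      define \<delta> where "\<delta> = \<epsilon> / K"
      have "\<delta> > 0"
        using that K by (simp add: \<delta>_def)
      from approx[OF this] obtain F F1 F2 where F:
        "\<And>t. (F has_vector_derivative F1 t) (at t)" "\<And>t. (F1 has_vector_derivative F2 t) (at t)"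
        "\<And>t. norm (F2 t - (a + b) * F1 t + a * b * F t) \<le> \<delta>" "\<And>t. norm (F t - J t) \<le> \<delta>"
        by metis
      define E where "E = (\<lambda>t. J t - F t)"
      have E: "norm (E t) \<le> \<delta>" for t
        using F(4)[of t] by (simp add: E_def norm_minus_commute)
      have E1: "norm (E (t + 1) - exp a * E t) \<le> (1 + norm (exp a)) * \<delta>" for t
      proof -
        have "norm (E (t + 1) - exp a * E t) \<le> norm (E (t + 1)) + norm (exp a) * norm (E t)"
          using norm_triangle_ineq4[of "E (t + 1)" "exp a * E t"] by (simp add: norm_mult)
        also have "\<dots> \<le> \<delta> + norm (exp a) * \<delta>"
          by (intro add_mono E mult_left_mono) auto
        finally show ?thesis by (simp add: algebra_simps)
      qed
      define D where "D = (E (t + 1 + 1) - exp a * E (t + 1)) - exp b * (E (t + 1) - exp a * E t)"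
      have "norm D \<le> norm (E (t + 1 + 1) - exp a * E (t + 1))
          + norm (exp b) * norm (E (t + 1) - exp a * E t)"
        unfolding D_def by (metis norm_triangle_ineq4 norm_mult)
      also have "\<dots> \<le> (1 + norm (exp a)) * \<delta> + norm (exp b) * ((1 + norm (exp a)) * \<delta>)"
        by (intro add_mono E1 mult_left_mono) auto
      finally have D: "norm D \<le> (1 + norm (exp a) + norm (exp b) * (1 + norm (exp a))) * \<delta>"
        by (simp add: algebra_simps)
      have "T (t + 1) - exp b * T t
          = ((F (t + 2) - exp a * F (t + 1)) - exp b * (F (t + 1) - exp a * F t)) + D"
        by (simp add: T_def E_def D_def algebra_simps)
      also have "norm \<dots> \<le> exp (2 * norm b) * (exp (2 * norm a) * \<delta>)
          + (1 + norm (exp a) + norm (exp b) * (1 + norm (exp a))) * \<delta>"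
        by (rule norm_triangle_mono[OF second_order_step_bound[OF F(1-3)] D])
      also have "\<dots> = K * \<delta>"
        by (simp add: K_def algebra_simps)
      also have "\<dots> = \<epsilon>"
        using K by (simp add: \<delta>_def)
      finally show ?thesis .
    qed
    then have "norm (T (t + 1) - exp b * T t) \<le> 0"
      by (rule field_le_epsilon) simp
    then show ?thesis by simp
  qed
  \<comment> \<open>The decay is used twice: first for \<open>T\<close>, which is geometric with
    ratio \<open>exp b\<close>, and then for \<open>J\<close> itself, which is geometric with ratio
    \<open>exp a\<close> once \<open>T\<close> is zero.\<close>
  then have "T t = 0" for t
    by (rule geometric_zero) (use shifted_tendsto_0[OF top bot, of "exp a"] in \<open>simp_all add: T_def\<close>)
  then have "J (t + 1) = exp a * J t" for t
    by (simp add: T_def)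
  then show ?thesis
    by (rule geometric_zero) (use top bot in simp_all)
qed

subsection \<open>The cut-off weights\<close>

text \<open>This is \<open>cos h * (1 - d / cos h)\<^sup>2 * sin h ^ k\<close> multiplied out, so
  that the powers of \<open>d\<close> are separated.\<close>

definition cutoff_weight :: "real \<Rightarrow> nat \<Rightarrow> real \<Rightarrow> real" where
  "cutoff_weight d k h = (cos h - 2 * d + d\<^sup>2 / cos h) * sin h ^ k"

text \<open>
  The truncated exponents \<open>k - 1\<close> and \<open>k - 2\<close> below only occur next to a factor that is 0 when \<open>k < 2\<close>.
\<close>

definition cutoff_weight1 :: "real \<Rightarrow> nat \<Rightarrow> real \<Rightarrow> real" where
  "cutoff_weight1 d k h = real k * sin h ^ (k - 1) * ((cos h)\<^sup>2 - 2 * d * cos h + d\<^sup>2)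
     - sin h ^ (k + 1) + d\<^sup>2 * (sin h ^ (k + 1) / (cos h)\<^sup>2)"

text \<open>The terms are sorted by powers of \<open>d\<close>: they come from the second
  derivatives of \<open>cos h * sin h ^ k\<close>, \<open>sin h ^ k\<close> and
  \<open>sin h ^ k / cos h\<close>. The part free of \<open>d\<close> produces the recursion between
  moments.\<close>

definition cutoff_weight2 :: "real \<Rightarrow> nat \<Rightarrow> real \<Rightarrow> real" where
  "cutoff_weight2 d k h =
     real (k * (k - 1)) * (cos h * sin h ^ (k - 2)) - (real k + 1)\<^sup>2 * (cos h * sin h ^ k)
     - 2 * d * (real (k * (k - 1)) * (sin h ^ (k - 2) * (cos h)\<^sup>2) - real k * sin h ^ k)
     + d\<^sup>2 * (real (k * (k - 1)) * (sin h ^ (k - 2) * cos h) + (real k + 1) * (sin h ^ k / cos h)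
         + 2 * (sin h ^ (k + 2) / cos h ^ 3))"

text \<open>Again sorted by powers of \<open>d\<close>, from the first derivatives of
  \<open>sin h ^ (k + 1)\<close> divided by 1, \<open>cos h\<close> and
  \<open>(cos h)\<^sup>2\<close>.\<close>

definition cutoff_weight_tan1 :: "real \<Rightarrow> nat \<Rightarrow> real \<Rightarrow> real" where
  "cutoff_weight_tan1 d k h =
     (real k + 1) * (cos h * sin h ^ k)
     - 2 * d * ((real k + 1) * sin h ^ k + sin h ^ (k + 2) / (cos h)\<^sup>2)
     + d\<^sup>2 * ((real k + 1) * (sin h ^ k / cos h) + 2 * (sin h ^ (k + 2) / cos h ^ 3))"

lemma DERIV_cutoff_weight:
  assumes "cos h > 0"
  shows "(cutoff_weight d k has_real_derivative cutoff_weight1 d k h) (at h)"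
proof -
  have "((\<lambda>h. (cos h - 2 * d + d\<^sup>2 / cos h) * sin h ^ k) has_real_derivative
     (- sin h + d\<^sup>2 * sin h / (cos h)\<^sup>2) * sin h ^ k
     + (cos h - 2 * d + d\<^sup>2 / cos h) * (real k * sin h ^ (k - 1) * cos h)) (at h)"
    using assms by (auto intro!: derivative_eq_intros simp: power2_eq_square)
  moreover have "(- sin h + d\<^sup>2 * sin h / (cos h)\<^sup>2) * sin h ^ k
     + (cos h - 2 * d + d\<^sup>2 / cos h) * (real k * sin h ^ (k - 1) * cos h) = cutoff_weight1 d k h"
    using assms unfolding cutoff_weight1_def by (simp add: field_simps power2_eq_square)
  ultimately show ?thesis
    unfolding cutoff_weight_def by metis
qed

lemma DERIV_cutoff_weight1:
  assumes "cos h > 0"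
  shows "(cutoff_weight1 d k has_real_derivative cutoff_weight2 d k h) (at h)"
proof -
  define X where "X = real k * (real (k - 1) * sin h ^ (k - 2) * cos h)"
  have pw: "((\<lambda>h. real k * sin h ^ (k - 1)) has_real_derivative X) (at h)"
    unfolding X_def by (auto intro!: derivative_eq_intros simp: diff_diff_left numeral_2_eq_2)
  define P where "P = (\<lambda>h::real. sin h ^ (k + 1))"
  define R where "R = (\<lambda>h::real. real k * sin h ^ (k - 1))"
  have dP: "(P has_real_derivative (real k + 1) * sin h ^ k * cos h) (at h)"
    unfolding P_def by (rule derivative_eq_intros refl)+ simp
  have dR: "(R has_real_derivative X) (at h)"
    unfolding R_def by (rule pw)
  have Psin: "sin h ^ (k + 2) = P h * sin h"
    by (simp add: P_def)
  have w1: "cutoff_weight1 d k = (\<lambda>h. R h * ((cos h)\<^sup>2 - 2 * d * cos h + d\<^sup>2)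
     - P h + d\<^sup>2 * (P h / (cos h)\<^sup>2))"
    by (simp add: fun_eq_iff cutoff_weight1_def P_def R_def)
  have "(cutoff_weight1 d k has_real_derivative
      X * ((cos h)\<^sup>2 - 2 * d * cos h + d\<^sup>2)
      + real k * sin h ^ (k - 1) * (- 2 * sin h * cos h + 2 * d * sin h)
      - (real k + 1) * sin h ^ k * cos h
      + d\<^sup>2 * ((real k + 1) * sin h ^ k / cos h + 2 * (sin h ^ (k + 2) / cos h ^ 3))) (at h)"
    unfolding w1 Psin R_def[THEN fun_cong, symmetric] using assms
    by (auto intro!: derivative_eq_intros dP dR simp: field_simps power2_eq_square power3_eq_cube)
  moreover have "X * ((cos h)\<^sup>2 - 2 * d * cos h + d\<^sup>2)
      + real k * sin h ^ (k - 1) * (- 2 * sin h * cos h + 2 * d * sin h)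
      - (real k + 1) * sin h ^ k * cos h
      + d\<^sup>2 * ((real k + 1) * sin h ^ k / cos h + 2 * (sin h ^ (k + 2) / cos h ^ 3))
      = cutoff_weight2 d k h"
  proof -
    have k1: "real k * sin h ^ (k - 1) * sin h = real k * sin h ^ k"
      by (cases k) auto
    \<comment> \<open>For \<open>k < 2\<close> the truncated exponent spoils the law of powers, but
      then both sides carry the factor 0.\<close>
    have "real (k * (k - 1)) * (sin h ^ (k - 2) * (sin h)\<^sup>2) = real (k * (k - 1)) * sin h ^ k"
    proof (cases "k < 2")
      case True
      then have "k = 0 \<or> k = 1" by auto
      then show ?thesis by auto
    next
      case False
      then obtain j where "k = j + 2"
        by (metis add.commute le_Suc_ex not_less)
      then show ?thesis by (simp add: power2_eq_square)
    qed
    \<comment> \<open>Writing \<open>(cos h)\<^sup>2\<close> as \<open>1 - (sin h)\<^sup>2\<close>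
      removes the cube of \<open>cos h\<close> and brings out the moment weight of order
      \<open>k - 2\<close>.\<close>
    moreover have "X * (cos h)\<^sup>2 = X - real (k * (k - 1)) * (sin h ^ (k - 2) * (sin h)\<^sup>2) * cos h"
      unfolding X_def cos_squared_eq of_nat_mult by algebra
    ultimately have k2: "X * (cos h)\<^sup>2 = X - real (k * (k - 1)) * sin h ^ k * cos h"
      by simp
    have kk: "real (k * (k - 1)) = real k * real k - real k"
      by (cases k) (auto simp: algebra_simps)
    have "X * ((cos h)\<^sup>2 - 2 * d * cos h + d\<^sup>2)
       + real k * sin h ^ (k - 1) * (- 2 * sin h * cos h + 2 * d * sin h)
      = X * (cos h)\<^sup>2 - 2 * d * (X * cos h) + d\<^sup>2 * X
        + (real k * sin h ^ (k - 1) * sin h) * (2 * d - 2 * cos h)"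
      by (simp add: algebra_simps)
    also have "\<dots> = X - (real k * real k - real k) * sin h ^ k * cos h
        - 2 * d * (X * cos h) + d\<^sup>2 * X + (real k * sin h ^ k) * (2 * d - 2 * cos h)"
      unfolding k1 k2 kk ..
    finally have *: "X * ((cos h)\<^sup>2 - 2 * d * cos h + d\<^sup>2)
       + real k * sin h ^ (k - 1) * (- 2 * sin h * cos h + 2 * d * sin h)
      = X - (real k * real k - real k) * sin h ^ k * cos h
        - 2 * d * (X * cos h) + d\<^sup>2 * X + (real k * sin h ^ k) * (2 * d - 2 * cos h)" .
    have X: "real (k * (k - 1)) * (cos h * sin h ^ (k - 2)) = X"
        "real (k * (k - 1)) * (sin h ^ (k - 2) * cos h) = X"
        "real (k * (k - 1)) * (sin h ^ (k - 2) * (cos h)\<^sup>2) = X * cos h"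
      unfolding X_def of_nat_mult power2_eq_square by (simp_all only: mult_ac)
    show ?thesis
      unfolding cutoff_weight2_def X * by (simp add: algebra_simps power2_eq_square)
  qed
  ultimately show ?thesis
    by metis
qed

lemma DERIV_tan_cutoff_weight:
  assumes "cos h > 0"
  shows "((\<lambda>h. tan h * cutoff_weight d k h) has_real_derivative cutoff_weight_tan1 d k h) (at h)"
proof -
  define X where "X = (\<lambda>h. sin h ^ (k + 1) - 2 * d * (sin h ^ (k + 1) / cos h)
      + d\<^sup>2 * (sin h ^ (k + 1) / (cos h)\<^sup>2))"
  define P where "P = (\<lambda>h::real. sin h ^ (k + 1))"
  have dP: "(P has_real_derivative (real k + 1) * sin h ^ k * cos h) (at h)"
    unfolding P_def by (rule derivative_eq_intros refl)+ simp
  have Psin: "sin h ^ (k + 2) = P h * sin h"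
    by (simp add: P_def)
  have X: "X = (\<lambda>h. P h - 2 * d * (P h / cos h) + d\<^sup>2 * (P h / (cos h)\<^sup>2))"
    by (simp add: X_def P_def)
  have dX: "(X has_real_derivative cutoff_weight_tan1 d k h) (at h)"
    unfolding X cutoff_weight_tan1_def Psin using assms
    by (auto intro!: derivative_eq_intros dP simp: field_simps power2_eq_square power3_eq_cube)
  \<comment> \<open>The simplification to \<open>X\<close> cancels \<open>cos h\<close>, so it is
    justified on the open set where \<open>cos\<close> is positive; agreement near \<open>h\<close>
    is enough for the derivative.\<close>
  have "eventually (\<lambda>h. h \<in> cos -` {0<..}) (nhds h)"
    using assms continuous_on_cos[OF continuous_on_id]
    by (intro eventually_nhds_in_open open_vimage) auto
  then have ev: "eventually (\<lambda>h. tan h * cutoff_weight d k h = X h) (nhds h)"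
    by eventually_elim (simp add: X_def cutoff_weight_def tan_def field_simps power2_eq_square)
  show ?thesis
    using dX unfolding DERIV_cong_ev[OF refl ev refl] .
qed

text \<open>The factor \<open>(cos h - d)\<^sup>2\<close> has a double zero where
  \<open>cos h = d\<close>; these are the end conditions of the integration by parts.\<close>

lemma cutoff_weight_ends:
  assumes "cos h = d" "d > 0"
  shows "cutoff_weight d k h = 0" "cutoff_weight1 d k h = 0"
  using assms by (auto simp: cutoff_weight_def cutoff_weight1_def power2_eq_square)

lemma cutoff_weight_approx:
  assumes "0 < d" "d \<le> cos h"
  shows "\<bar>cutoff_weight d k h - cos h * sin h ^ k\<bar> \<le> 2 * d"
proof -
  have "d\<^sup>2 / cos h \<le> d" "d\<^sup>2 / cos h \<ge> 0"
    using assms by (auto simp: field_simps power2_eq_square)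
  then have "\<bar>d\<^sup>2 / cos h - 2 * d\<bar> \<le> 2 * d"
    using assms by auto
  moreover have "\<bar>sin h ^ k\<bar> \<le> 1"
    by (simp add: power_abs power_le_one)
  ultimately have "\<bar>d\<^sup>2 / cos h - 2 * d\<bar> * \<bar>sin h ^ k\<bar> \<le> 2 * d * 1"
    using assms by (intro mult_mono) auto
  moreover have "cutoff_weight d k h - cos h * sin h ^ k = (d\<^sup>2 / cos h - 2 * d) * sin h ^ k"
    by (simp add: cutoff_weight_def algebra_simps)
  ultimately show ?thesis
    by (simp add: abs_mult)
qed

lemma cutoff_weight_defect:
  fixes m :: complex
  obtains K where "K \<ge> 0"
    "\<And>d h. 0 < d \<Longrightarrow> d \<le> cos h \<Longrightarrow>
      norm (of_real (cutoff_weight2 d k h) + m * of_real (cutoff_weight_tan1 d k h)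
        - (of_nat k + 1) * (m - (of_nat k + 1)) * of_real (cutoff_weight d k h)
        - of_real (real (k * (k - 1)) * (cos h * sin h ^ (k - 2)))) \<le> K * (d / (cos h)\<^sup>2)"
proof -
  define \<alpha> where "\<alpha> = (of_nat k + 1) * (m - (of_nat k + 1))"
  define q where "q = real (k * (k - 1))"
  define B1 where "B1 = (q + real k) + norm m * (real k + 2) + norm \<alpha>"
  define B2 where "B2 = (q + real k + 3) + norm m * (real k + 3) + norm \<alpha>"
  have q: "q \<ge> 0" by (simp add: q_def)
  have lin: "norm (of_real x + m * of_real y - \<alpha> * of_real z) \<le> X + norm m * Y + norm \<alpha>"
    if "\<bar>x\<bar> \<le> X" "\<bar>y\<bar> \<le> Y" "\<bar>z\<bar> \<le> 1" for x y z X Y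
  proof -
    have "norm (of_real x + m * of_real y - \<alpha> * of_real z)
        \<le> norm (of_real x + m * of_real y) + norm (\<alpha> * of_real z)"
      by (rule norm_triangle_ineq4)
    also have "norm (of_real x + m * of_real y) \<le> norm (of_real x :: complex) + norm (m * of_real y)"
      by (rule norm_triangle_ineq)
    also have "norm (of_real x :: complex) + norm (m * of_real y) + norm (\<alpha> * of_real z)
        \<le> X + norm m * Y + norm \<alpha> * 1"
      unfolding norm_mult norm_of_real using that by (intro add_mono mult_left_mono) auto
    finally show ?thesis by simp
  qed
  have "norm (of_real (cutoff_weight2 d k h) + m * of_real (cutoff_weight_tan1 d k h)
        - \<alpha> * of_real (cutoff_weight d k h) - of_real (q * (cos h * sin h ^ (k - 2))))
      \<le> (2 * B1 + B2) * (d / (cos h)\<^sup>2)" if d: "0 < d" "d \<le> cos h" for d h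
  proof -
    define C where "C = cos h"
    have C: "0 < C" "C \<le> 1" "d \<le> C"
      using d by (auto simp: C_def)
    have s: "\<bar>sin h ^ j\<bar> \<le> 1" for j
      by (simp add: power_abs power_le_one)
    have mul: "\<bar>x * y\<bar> \<le> X" if "\<bar>x\<bar> \<le> X" "\<bar>y\<bar> \<le> 1" for x y X :: real
      using mult_mono[OF that] that by (simp add: abs_mult)
    define x1 where "x1 = q * (sin h ^ (k - 2) * C\<^sup>2) - real k * sin h ^ k"
    define y1 where "y1 = (real k + 1) * sin h ^ k + sin h ^ (k + 2) / C\<^sup>2"
    define x2 where "x2 = q * (sin h ^ (k - 2) * C) + (real k + 1) * (sin h ^ k / C)
        + 2 * (sin h ^ (k + 2) / C ^ 3)"
    define y2 where "y2 = (real k + 1) * (sin h ^ k / C) + 2 * (sin h ^ (k + 2) / C ^ 3)"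
    define E1 where "E1 = of_real x1 + m * of_real y1 - \<alpha> * of_real (sin h ^ k)"
    define E2 where "E2 = of_real x2 + m * of_real y2 - \<alpha> * of_real (sin h ^ k / C)"
    \<comment> \<open>Here \<open>z\<close> stands for \<open>k + 1\<close>, \<open>e\<close> for
      \<open>cos h * sin h ^ k\<close>, \<open>b\<close> for \<open>d\<close>, and
      \<open>p * g\<close> for the term of order \<open>k - 2\<close>; the identity is the
      cancellation of everything free of \<open>b\<close>.\<close>
    have alg: "(p * g - z\<^sup>2 * e - 2 * b * X1 + b\<^sup>2 * X2) + m * (z * e - 2 * b * Y1 + b\<^sup>2 * Y2)
        - z * (m - z) * (e - 2 * b * r + b\<^sup>2 * r') - p * g
      = - 2 * b * (X1 + m * Y1 - z * (m - z) * r) + b\<^sup>2 * (X2 + m * Y2 - z * (m - z) * r')"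
      for p g z e b X1 X2 Y1 Y2 r r' :: complex
      by algebra
    have eq: "of_real (cutoff_weight2 d k h) + m * of_real (cutoff_weight_tan1 d k h)
        - \<alpha> * of_real (cutoff_weight d k h) - of_real (q * (cos h * sin h ^ (k - 2)))
      = - 2 * of_real d * E1 + of_real (d\<^sup>2) * E2"
    proof -
      have "cutoff_weight d k h = C * sin h ^ k - 2 * d * sin h ^ k + d\<^sup>2 * (sin h ^ k / C)"
        by (simp add: cutoff_weight_def C_def ring_distribs)
      moreover have "cutoff_weight_tan1 d k h
          = (real k + 1) * (C * sin h ^ k) - 2 * d * y1 + d\<^sup>2 * y2"
        unfolding cutoff_weight_tan1_def y1_def y2_def C_def ..
      moreover have "cutoff_weight2 d k h = q * (C * sin h ^ (k - 2))
          - (real k + 1)\<^sup>2 * (C * sin h ^ k) - 2 * d * x1 + d\<^sup>2 * x2"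
        unfolding cutoff_weight2_def x1_def x2_def C_def q_def ..
      ultimately show ?thesis
        unfolding E1_def E2_def C_def[symmetric] \<alpha>_def
        by (simp only: of_real_add of_real_diff of_real_mult of_real_power of_real_of_nat_eq
            of_real_numeral of_real_1 alg)
    qed
    have "norm (of_real (C\<^sup>2) * E1) \<le> B1"
    proof -
      have "\<bar>C\<^sup>2 * x1\<bar> \<le> q + real k"
      proof -
        have "\<bar>x1\<bar> \<le> \<bar>q * (sin h ^ (k - 2) * C\<^sup>2)\<bar> + \<bar>real k * sin h ^ k\<bar>"
          unfolding x1_def by (rule abs_triangle_ineq4)
        also have "\<dots> \<le> q + real k"
          using q C by (intro add_mono mul s) (auto simp: power_le_one)
        finally have "\<bar>x1 * C\<^sup>2\<bar> \<le> q + real k"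
          by (rule mul) (use C in \<open>auto simp: power_le_one\<close>)
        then show ?thesis by (simp add: mult.commute)
      qed
      moreover have "\<bar>C\<^sup>2 * y1\<bar> \<le> real k + 2"
      proof -
        have "C\<^sup>2 * y1 = ((real k + 1) * (sin h ^ k * C\<^sup>2)) + sin h ^ (k + 2)"
          using C by (simp add: y1_def field_simps)
        also have "\<bar>\<dots>\<bar> \<le> \<bar>(real k + 1) * (sin h ^ k * C\<^sup>2)\<bar> + \<bar>sin h ^ (k + 2)\<bar>"
          by (rule abs_triangle_ineq)
        also have "\<dots> \<le> (real k + 1) + 1"
          using C by (intro add_mono mul s) (auto simp: power_le_one)
        finally show ?thesis by simp
      qed
      moreover have "\<bar>C\<^sup>2 * sin h ^ k\<bar> \<le> 1"
        using C by (intro mul s) (auto simp: power_le_one)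
      ultimately have "norm (of_real (C\<^sup>2 * x1) + m * of_real (C\<^sup>2 * y1) - \<alpha> * of_real (C\<^sup>2 * sin h ^ k))
          \<le> B1"
        unfolding B1_def by (rule lin)
      then show ?thesis
        by (simp add: E1_def algebra_simps)
    qed
    then have "C\<^sup>2 * norm E1 \<le> B1"
      by (simp add: norm_mult norm_power)
    then have E1: "norm E1 \<le> B1 / C\<^sup>2"
      using C by (simp add: field_simps)
    \<comment> \<open>Multiplying by \<open>C ^ 3\<close> clears the denominators, leaving products
      of factors of size at most 1 with constants.\<close>
    have "norm (of_real (C ^ 3) * E2) \<le> B2"
    proof -
      have C3: "C ^ 3 * (sin h ^ j / C) = sin h ^ j * C\<^sup>2" "C ^ 3 * (sin h ^ j / C ^ 3) = sin h ^ j" for j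
        using C by (simp_all add: power2_eq_square power3_eq_cube)
      have ky: "C ^ 3 * y2 = (real k + 1) * (sin h ^ k * C\<^sup>2) + 2 * sin h ^ (k + 2)"
      proof -
        have "C ^ 3 * y2 = (real k + 1) * (C ^ 3 * (sin h ^ k / C)) + 2 * (C ^ 3 * (sin h ^ (k + 2) / C ^ 3))"
          unfolding y2_def by (simp only: ring_distribs mult.left_commute)
        then show ?thesis
          unfolding C3 .
      qed
      have "\<bar>(real k + 1) * (sin h ^ k * C\<^sup>2) + 2 * sin h ^ (k + 2)\<bar>
          \<le> \<bar>(real k + 1) * (sin h ^ k * C\<^sup>2)\<bar> + \<bar>2 * sin h ^ (k + 2)\<bar>"
        by (rule abs_triangle_ineq)
      also have "\<dots> \<le> (real k + 1) + 2"
        using C by (intro add_mono mul s) (auto simp: power_le_one)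
      finally have y: "\<bar>C ^ 3 * y2\<bar> \<le> real k + 3"
        unfolding ky by simp
      have "C ^ 3 * x2 = q * (sin h ^ (k - 2) * C ^ 4) + C ^ 3 * y2"
        unfolding x2_def y2_def by (simp add: algebra_simps eval_nat_numeral)
      also have "\<bar>\<dots>\<bar> \<le> \<bar>q * (sin h ^ (k - 2) * C ^ 4)\<bar> + \<bar>C ^ 3 * y2\<bar>"
        by (rule abs_triangle_ineq)
      also have "\<dots> \<le> q + (real k + 3)"
        using q C by (intro add_mono mul s y) (auto simp: power_le_one)
      finally have x: "\<bar>C ^ 3 * x2\<bar> \<le> q + real k + 3"
        by simp
      have z: "\<bar>sin h ^ k * C\<^sup>2\<bar> \<le> 1"
        using C by (intro mul s) (auto simp: power_le_one)
      have "norm (of_real (C ^ 3 * x2) + m * of_real (C ^ 3 * y2) - \<alpha> * of_real (sin h ^ k * C\<^sup>2)) \<le> B2"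
        unfolding B2_def by (rule lin[OF x y z])
      then show ?thesis
        unfolding C3(1)[symmetric] by (simp add: E2_def algebra_simps)
    qed
    then have "C ^ 3 * norm E2 \<le> B2"
      using C by (simp add: norm_mult norm_power)
    then have E2: "norm E2 \<le> B2 / C ^ 3"
      using C by (simp add: field_simps)
    have "norm (- 2 * of_real d * E1 + of_real (d\<^sup>2) * E2) \<le> 2 * d * norm E1 + d\<^sup>2 * norm E2"
      using norm_triangle_ineq[of "- 2 * of_real d * E1" "of_real (d\<^sup>2) * E2"] d
      by (simp add: norm_mult norm_power)
    also have "\<dots> \<le> 2 * d * (B1 / C\<^sup>2) + d\<^sup>2 * (B2 / C ^ 3)"
      using d E1 E2 by (intro add_mono mult_left_mono) auto
    also have "d\<^sup>2 * (B2 / C ^ 3) = (d / C) * (B2 * (d / C\<^sup>2))"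
      using C by (simp add: field_simps power2_eq_square power3_eq_cube)
    also have "\<dots> \<le> 1 * (B2 * (d / C\<^sup>2))"
      using C d q unfolding B2_def by (intro mult_right_mono) auto
    finally show ?thesis
      unfolding eq by (simp add: C_def algebra_simps add_divide_distrib)
  qed
  moreover have "2 * B1 + B2 \<ge> 0"
    using q by (simp add: B1_def B2_def)
  ultimately show ?thesis
    using that unfolding \<alpha>_def q_def by blast
qed

subsection \<open>Moments on half circles\<close>

lemma partial_derivs_C2:
  assumes "Ck_on 2 u half_plane"
  shows "Ck_on (Suc 0) (partial_x u) half_plane" "Ck_on (Suc 0) (partial_y u) half_plane"
    "continuous_on half_plane u"
    "continuous_on half_plane (partial_x u)" "continuous_on half_plane (partial_y u)"
    "continuous_on half_plane (partial_x (partial_x u))"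
    "continuous_on half_plane (partial_y (partial_x u))"
    "continuous_on half_plane (partial_x (partial_y u))"
    "continuous_on half_plane (partial_y (partial_y u))"
  using assms by (simp_all add: numeral_2_eq_2)

text \<open>By the chain rule the polar expression equals \<open>exp (2 * t)\<close> times
  \<open>L_op m u\<close>: in \<open>Utt + Uhh\<close> each mixed derivative and the first-order
  terms cancel, and \<open>Ut - tan h * Uh\<close> is \<open>(x\<^sup>2 + y\<^sup>2) / x\<close>
  times the \<open>x\<close>-derivative. The bound \<open>c < pi / 2\<close> keeps the arc inside
  the half plane.\<close>

lemma polar_mean_ODE:
  fixes m :: complex and w w1 w2 v1 :: "real \<Rightarrow> real"
  assumes C2: "Ck_on 2 u half_plane"
    and L: "\<forall>p\<in>half_plane. L_op m u p = 0"
    and c: "0 < c" "c < pi / 2"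
    and w: "\<And>h. h \<in> {-c..c} \<Longrightarrow> (w has_real_derivative w1 h) (at h)"
      "\<And>h. h \<in> {-c..c} \<Longrightarrow> (w1 has_real_derivative w2 h) (at h)"
      "\<And>h. h \<in> {-c..c} \<Longrightarrow> ((\<lambda>h. tan h * w h) has_real_derivative v1 h) (at h)"
      "w c = 0" "w (-c) = 0" "w1 c = 0" "w1 (-c) = 0"
  obtains A1 A2 where
    "\<And>t. ((\<lambda>t. integral {-c..c} (\<lambda>h. u (log_polar t h) * of_real (w h))) has_vector_derivative A1 t) (at t)"
    "\<And>t. (A1 has_vector_derivative A2 t) (at t)"
    "\<And>t. ((\<lambda>h. u (log_polar t h) * (of_real (w2 h) + m * of_real (v1 h))) has_integral
            - (A2 t + m * A1 t)) {-c..c}"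
proof -
  note D = partial_derivs_C2[OF C2]
  define x y where "x = (\<lambda>t h :: real. exp t * cos h)"
    and "y = (\<lambda>t h :: real. exp t * sin h)"
  define P where "P = (\<lambda>(f :: real \<times> real \<Rightarrow> complex) t h. f (log_polar t h))"
  define ux uy uxx uxy uyx uyy where "ux = P (partial_x u)" and "uy = P (partial_y u)"
    and "uxx = P (partial_x (partial_x u))" and "uxy = P (partial_y (partial_x u))"
    and "uyx = P (partial_x (partial_y u))" and "uyy = P (partial_y (partial_y u))"
  define Ut where "Ut = (\<lambda>t h. x t h *\<^sub>R ux t h + y t h *\<^sub>R uy t h)"
  define Uh where "Uh = (\<lambda>t h. - y t h *\<^sub>R ux t h + x t h *\<^sub>R uy t h)"
  define Utt where "Utt = (\<lambda>t h.
      (x t h *\<^sub>R (x t h *\<^sub>R uxx t h + y t h *\<^sub>R uxy t h) + x t h *\<^sub>R ux t h)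
      + (y t h *\<^sub>R (x t h *\<^sub>R uyx t h + y t h *\<^sub>R uyy t h) + y t h *\<^sub>R uy t h))"
  define Uhh where "Uhh = (\<lambda>t h.
      (- y t h *\<^sub>R (- y t h *\<^sub>R uxx t h + x t h *\<^sub>R uxy t h) + - x t h *\<^sub>R ux t h)
      + (x t h *\<^sub>R (- y t h *\<^sub>R uyx t h + x t h *\<^sub>R uyy t h) + - y t h *\<^sub>R uy t h))"
  have cos: "cos h > 0" if "h \<in> {-c..c}" for h
    using that c by (intro cos_gt_zero_pi) auto
  note defs = ux_def uy_def uxx_def uxy_def uyx_def uyy_def P_def
  have dU: "((\<lambda>t. P u t h) has_vector_derivative Ut t h) (at t)"
      "(P u t has_vector_derivative Uh t h) (at h)"
    if "h \<in> {-c..c}" for t h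
    using has_vector_derivative_log_polar[of "Suc 0" u h t] C2 cos[OF that]
    unfolding Ut_def Uh_def defs x_def y_def by (simp_all add: numeral_2_eq_2)
  have dx: "((\<lambda>t. ux t h) has_vector_derivative x t h *\<^sub>R uxx t h + y t h *\<^sub>R uxy t h) (at t)"
      "(ux t has_vector_derivative - y t h *\<^sub>R uxx t h + x t h *\<^sub>R uxy t h) (at h)"
    if "h \<in> {-c..c}" for t h
    using has_vector_derivative_log_polar[OF D(1) cos[OF that], of t]
    unfolding defs x_def y_def by simp_all
  have dy: "((\<lambda>t. uy t h) has_vector_derivative x t h *\<^sub>R uyx t h + y t h *\<^sub>R uyy t h) (at t)"
      "(uy t has_vector_derivative - y t h *\<^sub>R uyx t h + x t h *\<^sub>R uyy t h) (at h)"
    if "h \<in> {-c..c}" for t h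
    using has_vector_derivative_log_polar[OF D(2) cos[OF that], of t]
    unfolding defs x_def y_def by simp_all
  have xt: "((\<lambda>t. x t h) has_real_derivative x t h) (at t)"
      "((\<lambda>t. y t h) has_real_derivative y t h) (at t)"
      "(x t has_real_derivative - y t h) (at h)"
      "(y t has_real_derivative x t h) (at h)"
      "((\<lambda>h. - y t h) has_real_derivative - x t h) (at h)" for t h
    unfolding x_def y_def by (auto intro!: derivative_eq_intros)
  have cont: "continuous_on (UNIV \<times> {-c..c}) (\<lambda>p. P f (fst p) (snd p))"
    if "continuous_on half_plane f" for f
    using continuous_on_compose_log_polar[OF that, of "UNIV \<times> {-c..c}"] cos
    by (simp add: P_def split_def)
  have contx: "continuous_on S (\<lambda>p. x (fst p) (snd p))" "continuous_on S (\<lambda>p. y (fst p) (snd p))" for S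
    unfolding x_def y_def by (intro continuous_intros)+
  show ?thesis
  proof (rule weighted_mean_ODE[where U = "P u" and c = c and w = w and m = m, OF c(1) dU(1) _ dU(2) _ _ _ _ _ w])
    show "((\<lambda>t. Ut t h) has_vector_derivative Utt t h) (at t)" if "h \<in> {-c..c}" for t h
      unfolding Ut_def Utt_def
      by (intro has_vector_derivative_add has_vector_derivative_scaleR xt dx dy that)
    show "(Uh t has_vector_derivative Uhh t h) (at h)" if "h \<in> {-c..c}" for t h
      unfolding Uh_def Uhh_def
      by (intro has_vector_derivative_add has_vector_derivative_scaleR xt dx dy that)
    show "continuous_on (UNIV \<times> {-c..c}) (\<lambda>(t, h). P u t h)"
      "continuous_on (UNIV \<times> {-c..c}) (\<lambda>(t, h). Ut t h)"
      "continuous_on (UNIV \<times> {-c..c}) (\<lambda>(t, h). Utt t h)"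
      unfolding Ut_def Utt_def split_def ux_def uy_def uxx_def uxy_def uyx_def uyy_def
      by (intro continuous_intros cont contx D)+
    show "Utt t h + m * Ut t h + Uhh t h - m * of_real (tan h) * Uh t h = 0"
      if "h \<in> {-c..c}" for t h
    proof -
      define X Y where "X = complex_of_real (x t h)" and "Y = complex_of_real (y t h)"
      have X: "X \<noteq> 0"
        using cos[OF that] by (simp add: X_def x_def)
      have tan: "of_real (tan h) = Y / X"
        by (simp add: X_def Y_def x_def y_def tan_def)
      have "L_op m u (log_polar t h) = 0"
        using L log_polar_in_half_plane[OF cos[OF that]] by blast
      then have eq: "uxx t h = - uyy t h - m / X * ux t h"
        by (simp add: L_op_def laplacian_def defs X_def x_def algebra_simps eq_neg_iff_add_eq_0)
      show ?thesis
        unfolding Utt_def Ut_def Uhh_def Uh_def scaleR_conv_of_real of_real_minus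
          X_def[symmetric] Y_def[symmetric] tan eq
        using X by (simp add: field_simps)
    qed
  next
    fix A1 A2
    assume "\<And>t. ((\<lambda>t. integral {-c..c} (\<lambda>h. P u t h * of_real (w h))) has_vector_derivative A1 t) (at t)"
      "\<And>t. (A1 has_vector_derivative A2 t) (at t)"
      "\<And>t. ((\<lambda>h. P u t h * (of_real (w2 h) + m * of_real (v1 h))) has_integral
          - (A2 t + m * A1 t)) {-c..c}"
    then show thesis
      unfolding P_def by (rule that)
  qed
qed

section \<open>Extension by zero and uniform smallness near the boundary\<close>

text \<open>The extension gives the integrands a meaning on closed half circles, whose end points
  lie on the line \<open>x = 0\<close>; the decay of \<open>u\<close> makes it continuous on the
  whole plane.\<close>

definition zero_ext :: "(real \<times> real \<Rightarrow> complex) \<Rightarrow> real \<times> real \<Rightarrow> complex" where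
  "zero_ext u p = (if p \<in> half_plane then u p else 0)"

lemma zero_ext_small:
  assumes "vanishes_at_boundary u" "\<epsilon> > 0"
  obtains \<eta> where "\<eta> > 0" "\<And>p. fst p \<le> \<eta> \<or> norm p \<ge> 1 / \<eta> \<Longrightarrow> norm (zero_ext u p) \<le> \<epsilon>"
proof -
  obtain N :: nat where N: "N \<ge> 1" "\<And>n p. n \<ge> N \<Longrightarrow> p \<in> half_plane \<Longrightarrow>
      fst p \<le> 1 / real n \<or> norm p \<ge> real n \<Longrightarrow> norm (u p) \<le> \<epsilon>"
    using assms unfolding vanishes_at_boundary_def by fastforce
  show ?thesis
  proof (rule that)
    show "1 / real N > 0"
      using N(1) by simp
    show "norm (zero_ext u p) \<le> \<epsilon>" if "fst p \<le> 1 / real N \<or> norm p \<ge> 1 / (1 / real N)" for p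
      using N(2)[of N p] that assms(2) by (auto simp: zero_ext_def)
  qed
qed

lemma continuous_zero_ext:
  assumes "continuous_on half_plane u" "vanishes_at_boundary u"
  shows "continuous_on UNIV (zero_ext u)"
proof -
  have hp: "half_plane = {0<..} \<times> (UNIV :: real set)"
    by (auto simp: half_plane_def)
  have op: "open half_plane"
    unfolding hp by (intro open_Times) auto
  have "isCont (zero_ext u) p" for p
  proof (cases "p \<in> half_plane")
    case True
    have "continuous_on half_plane (zero_ext u)"
      using assms(1) by (rule continuous_on_eq) (simp add: zero_ext_def)
    then show ?thesis
      using op True by (simp add: continuous_on_eq_continuous_at)
  next
    case False
    then have p: "fst p \<le> 0" "zero_ext u p = 0"
      by (auto simp: half_plane_def zero_ext_def split: prod.splits)
    have "(zero_ext u \<longlongrightarrow> 0) (at p)"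
    proof (rule tendstoI)
      fix e :: real assume "e > 0"
      then obtain \<eta> where \<eta>: "\<eta> > 0"
          "\<And>p. fst p \<le> \<eta> \<or> norm p \<ge> 1 / \<eta> \<Longrightarrow> norm (zero_ext u p) \<le> e / 2"
        using zero_ext_small[OF assms(2), of "e / 2"] by (metis half_gt_zero)
      \<comment> \<open>As \<open>fst p \<le> 0\<close>, this open set is a neighbourhood of
        \<open>p\<close>, and the extension is uniformly small on it.\<close>
      have "open {q :: real \<times> real. fst q < \<eta>}"
        by (intro open_Collect_less continuous_intros)
      then have "eventually (\<lambda>q. q \<in> {q. fst q < \<eta>}) (at p)"
        using p \<eta> by (intro eventually_at_in_open') auto
      then show "eventually (\<lambda>q. dist (zero_ext u q) 0 < e) (at p)"
      proof eventually_elim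
        case (elim q)
        then have "norm (zero_ext u q) \<le> e / 2"
          by (intro \<eta>(2)) auto
        then show ?case using \<open>e > 0\<close> by simp
      qed
    qed
    with p(2) show ?thesis
      by (simp add: isCont_def)
  qed
  then show ?thesis
    by (simp add: continuous_on_eq_continuous_at)
qed

text \<open>Smallness outside a large ball is combined with continuity on the compact ball.\<close>

lemma bounded_zero_ext:
  assumes "continuous_on half_plane u" "vanishes_at_boundary u"
  obtains M where "M > 0" "\<And>p. norm (zero_ext u p) \<le> M"
proof -
  obtain \<eta> where \<eta>: "\<eta> > 0" "\<And>p. fst p \<le> \<eta> \<or> norm p \<ge> 1 / \<eta> \<Longrightarrow> norm (zero_ext u p) \<le> 1"
    using zero_ext_small[OF assms(2), of 1] by auto
  have "compact (zero_ext u ` cball 0 (1 / \<eta>))"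
    using continuous_zero_ext[OF assms] continuous_on_subset
    by (intro compact_continuous_image compact_cball) blast
  then obtain B where B: "\<And>p. p \<in> cball 0 (1 / \<eta>) \<Longrightarrow> norm (zero_ext u p) \<le> B"
    using compact_imp_bounded bounded_iff by (metis imageI)
  have "norm (zero_ext u p) \<le> max 1 B" for p
    using \<eta>(2)[of p] B[of p] by (cases "norm p \<le> 1 / \<eta>") auto
  then show ?thesis
    by (intro that[of "max 1 B"]) auto
qed

text \<open>The bound is uniform in \<open>t\<close>. Either the radius is at least
  \<open>1 / \<eta>\<close> and the point is far out, or \<open>cos h \<le> \<eta>\<^sup>2\<close>
  forces \<open>x = exp t * cos h \<le> \<eta>\<close>; hence the witness
  \<open>\<eta>\<^sup>2\<close>.\<close>

lemma zero_ext_log_polar_small_angle: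
  assumes "vanishes_at_boundary u" "\<epsilon> > 0"
  obtains \<eta> where "\<eta> > 0" "\<And>t h. cos h \<le> \<eta> \<Longrightarrow> norm (zero_ext u (log_polar t h)) \<le> \<epsilon>"
proof -
  obtain \<eta> where \<eta>: "\<eta> > 0" "\<And>p. fst p \<le> \<eta> \<or> norm p \<ge> 1 / \<eta> \<Longrightarrow> norm (zero_ext u p) \<le> \<epsilon>"
    using zero_ext_small[OF assms] by blast
  have "norm (zero_ext u (log_polar t h)) \<le> \<epsilon>" if "cos h \<le> \<eta>\<^sup>2" for t h
  proof (cases "exp t \<ge> 1 / \<eta>")
    case True
    then show ?thesis
      by (intro \<eta>(2)) simp
  next
    case False
    have "exp t * cos h \<le> exp t * \<eta>\<^sup>2"
      using that by (intro mult_left_mono) auto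
    also have "\<dots> \<le> (1 / \<eta>) * \<eta>\<^sup>2"
      using False by (intro mult_right_mono) auto
    also have "\<dots> = \<eta>"
      using \<eta>(1) by (simp add: power2_eq_square)
    finally show ?thesis
      by (intro \<eta>(2)) simp
  qed
  then show ?thesis
    using \<eta>(1) by (intro that[of "\<eta>\<^sup>2"]) auto
qed

text \<open>Large \<open>t\<close> puts the point far out, and very negative \<open>t\<close> gives
  \<open>x \<le> exp t \<le> \<eta>\<close>. The threshold \<open>\<bar>ln \<eta>\<bar>\<close>
  serves both ends, uniformly in \<open>h\<close>.\<close>

lemma zero_ext_log_polar_small_radius:
  assumes "vanishes_at_boundary u" "\<epsilon> > 0"
  obtains T where "\<And>t h. \<bar>t\<bar> \<ge> T \<Longrightarrow> norm (zero_ext u (log_polar t h)) \<le> \<epsilon>"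
proof -
  obtain \<eta> where \<eta>: "\<eta> > 0" "\<And>p. fst p \<le> \<eta> \<or> norm p \<ge> 1 / \<eta> \<Longrightarrow> norm (zero_ext u p) \<le> \<epsilon>"
    using zero_ext_small[OF assms] by blast
  have "norm (zero_ext u (log_polar t h)) \<le> \<epsilon>" if "\<bar>t\<bar> \<ge> \<bar>ln \<eta>\<bar>" for t h
  proof (cases "t \<ge> 0")
    case True
    then have "exp t \<ge> exp (- ln \<eta>)"
      using that by auto
    then show ?thesis
      using \<eta>(1) by (intro \<eta>(2)) (simp add: exp_minus field_simps)
  next
    case False
    then have "exp t \<le> exp (ln \<eta>)"
      using that by (intro exp_le_cancel_iff[THEN iffD2]) linarith
    then have "exp t \<le> \<eta>"
      using \<eta>(1) by simp
    moreover have "exp t * cos h \<le> exp t * 1"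
      by (intro mult_left_mono) auto
    ultimately have "exp t * cos h \<le> \<eta>"
      by linarith
    then show ?thesis
      by (intro \<eta>(2)) simp
  qed
  then show ?thesis
    using that by blast
qed

section \<open>Estimates for integrals over truncated half circles\<close>

lemma norm_integral_le_const:
  fixes f :: "real \<Rightarrow> complex"
  assumes "continuous_on {a..b} f" "\<And>x. x \<in> {a..b} \<Longrightarrow> norm (f x) \<le> B" "a \<le> b"
  shows "norm (integral {a..b} f) \<le> B * (b - a)"
  using integral_bound[OF assms(3,1,2)] by simp

text \<open>On the two discarded pieces \<open>cos h \<le> cos c\<close>, and their total length is
  below \<open>pi\<close>.\<close>

lemma integral_truncate_bound:
  fixes g :: "real \<Rightarrow> complex"
  assumes cont: "continuous_on {-pi/2..pi/2} g" and c: "0 < c" "c < pi / 2"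
    and g: "\<And>h. h \<in> {-pi/2..pi/2} \<Longrightarrow> norm (g h) \<le> M * cos h" and M: "M \<ge> 0"
  shows "norm (integral {-pi/2..pi/2} g - integral {-c..c} g) \<le> M * cos c * pi"
proof -
  have int: "g integrable_on {a..b}" if "{a..b} \<subseteq> {-pi/2..pi/2}" for a b
    using continuous_on_subset[OF cont that] by (rule integrable_continuous_interval)
  have i1: "integral {-pi/2..pi/2} g = integral {-pi/2..-c} g + integral {-c..pi/2} g"
    using c by (intro Henstock_Kurzweil_Integration.integral_combine[symmetric] int) auto
  have i2: "integral {-c..pi/2} g = integral {-c..c} g + integral {c..pi/2} g"
    using c by (intro Henstock_Kurzweil_Integration.integral_combine[symmetric] int) auto
  have cos_le: "cos h \<le> cos c" if "h \<in> {-pi/2..-c} \<or> h \<in> {c..pi/2}" for h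
  proof -
    have "cos \<bar>h\<bar> \<le> cos c"
      using that c by (intro cos_monotone_0_pi_le) auto
    then show ?thesis by simp
  qed
  have b: "norm (integral {a..b} g) \<le> (M * cos c) * (b - a)"
    if "{a..b} \<subseteq> {-pi/2..-c} \<or> {a..b} \<subseteq> {c..pi/2}" "a \<le> b" for a b
  proof (rule norm_integral_le_const)
    have sub: "{a..b} \<subseteq> {-pi/2..pi/2}"
      using that(1) c by (auto simp: subset_iff)
    then show "continuous_on {a..b} g"
      by (rule continuous_on_subset[OF cont])
    show "norm (g h) \<le> M * cos c" if "h \<in> {a..b}" for h
    proof -
      have "norm (g h) \<le> M * cos h"
        using that sub by (intro g) auto
      also have "\<dots> \<le> M * cos c"
        using that \<open>_ \<or> _\<close> M by (intro mult_left_mono cos_le) auto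
      finally show ?thesis .
    qed
  qed fact
  have "norm (integral {-pi/2..pi/2} g - integral {-c..c} g)
      \<le> norm (integral {-pi/2..-c} g) + norm (integral {c..pi/2} g)"
    unfolding i1 i2 using norm_triangle_ineq by (simp add: algebra_simps)
  also have "\<dots> \<le> (M * cos c) * (- c - - pi / 2) + (M * cos c) * (pi / 2 - c)"
    using c by (intro add_mono b) auto
  also have "\<dots> = M * cos c * pi - 2 * c * (M * cos c)"
    by (simp add: algebra_simps)
  also have "\<dots> \<le> M * cos c * pi"
    using c M by (auto intro!: mult_nonneg_nonneg cos_ge_zero)
  finally show ?thesis .
qed

text \<open>The kernel bounding the cut-off error has total mass at most 2, however small
  \<open>cos c\<close> is.\<close>

lemma has_integral_sec_squared:
  assumes "0 < c" "c < pi / 2"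
  shows "((\<lambda>h. cos c / (cos h)\<^sup>2) has_integral 2 * sin c) {-c..c}"
proof -
  have cos: "cos h > 0" if "h \<in> {-c..c}" for h
    using that assms by (intro cos_gt_zero_pi) auto
  have "((\<lambda>h. cos c / (cos h)\<^sup>2) has_integral cos c * tan c - cos c * tan (-c)) {-c..c}"
  proof (rule fundamental_theorem_of_calculus)
    fix h assume "h \<in> {-c..c}"
    from cos[OF this] have "((\<lambda>h. cos c * tan h) has_real_derivative cos c / (cos h)\<^sup>2) (at h)"
      by (auto intro!: derivative_eq_intros simp: field_simps)
    then show "((\<lambda>h. cos c * tan h) has_vector_derivative cos c / (cos h)\<^sup>2) (at h within {-c..c})"
      by (simp add: has_real_derivative_iff_has_vector_derivative has_vector_derivative_at_within)
  qed (use assms in auto)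
  moreover have "cos c * tan c - cos c * tan (-c) = 2 * sin c"
    using cos[of c] assms by (simp add: tan_def)
  ultimately show ?thesis by metis
qed

section \<open>Sine moments and their differential equation\<close>

text \<open>The factor \<open>cos h\<close> is the Jacobian of \<open>s = sin h\<close>, so these
  are power moments in \<open>s\<close> over the interval from -1 to 1.\<close>

definition moment :: "(real \<times> real \<Rightarrow> complex) \<Rightarrow> nat \<Rightarrow> real \<Rightarrow> complex" where
  "moment u k t =
     integral {-pi/2..pi/2} (\<lambda>h. zero_ext u (log_polar t h) * of_real (cos h * sin h ^ k))"

lemma continuous_zero_ext_log_polar:
  assumes "continuous_on half_plane u" "vanishes_at_boundary u"
  shows "continuous_on S (\<lambda>h. zero_ext u (log_polar t h))"
  unfolding log_polar_def
  by (rule continuous_on_compose2[OF continuous_zero_ext[OF assms]]) (auto intro!: continuous_intros)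

lemma abs_cos_sin_power_le: "\<bar>cos h * sin h ^ k\<bar> \<le> \<bar>cos (h :: real)\<bar>"
  unfolding abs_mult by (simp add: power_abs power_le_one mult_left_le)

lemma moment_tendsto_0:
  assumes "continuous_on half_plane u" "vanishes_at_boundary u"
  shows "(moment u k \<longlongrightarrow> 0) at_top" "(moment u k \<longlongrightarrow> 0) at_bot"
proof -
  have small: "\<exists>T. \<forall>t. \<bar>t\<bar> \<ge> T \<longrightarrow> norm (moment u k t) < e" if "e > 0" for e
  proof -
    obtain T where T: "\<And>t h. \<bar>t\<bar> \<ge> T \<Longrightarrow> norm (zero_ext u (log_polar t h)) \<le> e / (2 * pi)"
      using zero_ext_log_polar_small_radius[OF assms(2), of "e / (2 * pi)"] \<open>e > 0\<close> by auto
    have "norm (moment u k t) < e" if "\<bar>t\<bar> \<ge> T" for t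
    proof -
      have "norm (moment u k t) \<le> (e / (2 * pi)) * (pi/2 - -pi/2)"
        unfolding moment_def
      proof (rule norm_integral_le_const)
        show "norm (zero_ext u (log_polar t h) * of_real (cos h * sin h ^ k)) \<le> e / (2 * pi)" for h
        proof -
          have "\<bar>cos h * sin h ^ k\<bar> \<le> 1"
            using abs_cos_sin_power_le[of h k] abs_cos_le_one[of h] by linarith
          then have "norm (zero_ext u (log_polar t h)) * \<bar>cos h * sin h ^ k\<bar> \<le> (e / (2 * pi)) * 1"
            using \<open>e > 0\<close> by (intro mult_mono T that) auto
          then show ?thesis
            by (simp only: norm_mult norm_of_real mult_1_right)
        qed
      qed (auto intro!: continuous_intros continuous_zero_ext_log_polar assms)
      also have "\<dots> < e"
        using \<open>e > 0\<close> by simp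
      finally show ?thesis .
    qed
    then show ?thesis by blast
  qed
  show "(moment u k \<longlongrightarrow> 0) at_top"
  proof (rule tendstoI)
    fix e :: real assume "e > 0"
    then obtain T where "\<forall>t. \<bar>t\<bar> \<ge> T \<longrightarrow> norm (moment u k t) < e"
      using small by blast
    then show "\<forall>\<^sub>F t in at_top. dist (moment u k t) 0 < e"
      unfolding eventually_at_top_linorder by (intro exI[of _ T]) auto
  qed
  show "(moment u k \<longlongrightarrow> 0) at_bot"
  proof (rule tendstoI)
    fix e :: real assume "e > 0"
    then obtain T where "\<forall>t. \<bar>t\<bar> \<ge> T \<longrightarrow> norm (moment u k t) < e"
      using small by blast
    then show "\<forall>\<^sub>F t in at_bot. dist (moment u k t) 0 < e"
      unfolding eventually_at_bot_linorder by (intro exI[of _ "- T"]) auto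
  qed
qed

text \<open>\<open>F\<close> is the moment with the cut-off weight on the arc where
  \<open>cos h \<ge> d\<close>. Its residual is an integral of the extension against the weight
  defect, split at \<open>cos h = \<eta>\<close>: below, the extension is at most
  \<open>\<epsilon>'\<close> and the kernel has bounded mass; above, the kernel is at most
  \<open>d / \<eta>\<^sup>2\<close>. Choosing \<open>\<eta>\<close> before \<open>d\<close> makes
  both parts small uniformly in \<open>t\<close>.\<close>

lemma moment_approx:
  fixes m :: complex
  assumes C2: "Ck_on 2 u half_plane"
    and L: "\<forall>p\<in>half_plane. L_op m u p = 0"
    and van: "vanishes_at_boundary u"
    and lower: "\<And>t. of_nat (k * (k - 1)) * moment u (k - 2) t = 0"
    and \<epsilon>: "\<epsilon> > 0"
  shows "\<exists>F F1 F2. \<forall>t. (F has_vector_derivative F1 t) (at t) \<and> (F1 has_vector_derivative F2 t) (at t)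
    \<and> norm (F2 t + m * F1 t + (of_nat k + 1) * (m - (of_nat k + 1)) * F t) \<le> \<epsilon>
    \<and> norm (F t - moment u k t) \<le> \<epsilon>"
proof -
  have cu: "continuous_on half_plane u"
    using partial_derivs_C2(3)[OF C2] .
  define V where "V = (\<lambda>t h. zero_ext u (log_polar t h))"
  have cV: "continuous_on S (V t)" for S t
    unfolding V_def by (rule continuous_zero_ext_log_polar[OF cu van])
  define \<alpha> where "\<alpha> = (of_nat k + 1) * (m - (of_nat k + 1))"
  obtain M where M: "M > 0" "\<And>t h. norm (V t h) \<le> M"
    using bounded_zero_ext[OF cu van] unfolding V_def by metis
  obtain K where K: "K \<ge> 0" and defect: "\<And>d h. 0 < d \<Longrightarrow> d \<le> cos h \<Longrightarrow>
      norm (of_real (cutoff_weight2 d k h) + m * of_real (cutoff_weight_tan1 d k h)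
        - \<alpha> * of_real (cutoff_weight d k h)
        - of_real (real (k * (k - 1)) * (cos h * sin h ^ (k - 2)))) \<le> K * (d / (cos h)\<^sup>2)"
    using cutoff_weight_defect[of k m] unfolding \<alpha>_def by metis
  \<comment> \<open>With kernel mass at most 2, the region near the boundary then contributes at
    most \<open>\<epsilon> / 2\<close>.\<close>
  define \<epsilon>' where "\<epsilon>' = \<epsilon> / (4 * (K + 1))"
  have \<epsilon>': "\<epsilon>' > 0" "2 * K * \<epsilon>' \<le> \<epsilon> / 2"
    using \<epsilon> K by (auto simp: \<epsilon>'_def field_simps)
  obtain \<eta> where \<eta>: "\<eta> > 0" "\<And>t h. cos h \<le> \<eta> \<Longrightarrow> norm (V t h) \<le> \<epsilon>'"
    using zero_ext_log_polar_small_angle[OF van \<epsilon>'(1)] unfolding V_def by metis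
  define q where "q = real (k * (k - 1))"
  \<comment> \<open>\<open>Q\<close> gathers the coefficients of all errors linear in
    \<open>d\<close>: the defect away from the boundary, the truncation of the moment of order
    \<open>k - 2\<close>, and the distance from \<open>F\<close> to the moment, with
    \<open>2 * M * pi\<close> from the weight and \<open>M * pi\<close> from truncation.\<close>
  define Q where "Q = K * M * pi / \<eta>\<^sup>2 + q * M * pi + 3 * M * pi"
  have Q: "Q > 0"
    unfolding Q_def using K M \<eta> by (intro add_nonneg_pos add_nonneg_nonneg) (auto simp: q_def)
  define d where "d = min (1 / 2) (\<epsilon> / (2 * Q))"
  have d: "0 < d" "d < 1" "d * Q \<le> \<epsilon> / 2"
    using \<epsilon> Q by (auto simp: d_def min_def field_simps)
  \<comment> \<open>The arc ends exactly where the cut-off weight has its double zeros.\<close>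
  define c where "c = arccos d"
  have cos_c: "cos c = d"
    using d by (simp add: c_def)
  have c: "0 < c" "c < pi / 2"
    using d arccos_lt_bounded[of d] arccos_less_arccos[of 0 d] by (auto simp: c_def)
  have cos_ge: "d \<le> cos h" if "h \<in> {-c..c}" for h
  proof -
    have "cos c \<le> cos \<bar>h\<bar>"
      using that c by (intro cos_monotone_0_pi_le) auto
    then show ?thesis by (simp add: cos_c)
  qed
  have cos_pos: "cos h > 0" if "h \<in> {-c..c}" for h
    using cos_ge[OF that] d by simp
  define w where "w = cutoff_weight d k"
  have cw: "continuous_on {-c..c} w"
    using DERIV_cutoff_weight cos_pos unfolding w_def
    by (meson DERIV_isCont continuous_at_imp_continuous_on)
  have ends: "w c = 0" "w (-c) = 0" "cutoff_weight1 d k c = 0" "cutoff_weight1 d k (-c) = 0"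
    unfolding w_def using d cos_c by (auto intro!: cutoff_weight_ends)
  define F where "F = (\<lambda>t. integral {-c..c} (\<lambda>h. V t h * of_real (w h)))"
  have uV: "u (log_polar t h) = V t h" if "h \<in> {-c..c}" for t h
    using log_polar_in_half_plane[OF cos_pos[OF that]] by (simp add: V_def zero_ext_def)
  have Feq: "F = (\<lambda>t. integral {-c..c} (\<lambda>h. u (log_polar t h) * of_real (w h)))"
    unfolding F_def by (intro ext integral_cong) (simp add: uV)
  obtain F1 F2 where F12: "\<And>t. (F has_vector_derivative F1 t) (at t)"
      "\<And>t. (F1 has_vector_derivative F2 t) (at t)"
    and F2: "\<And>t. ((\<lambda>h. u (log_polar t h)
        * (of_real (cutoff_weight2 d k h) + m * of_real (cutoff_weight_tan1 d k h))) has_integral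
            - (F2 t + m * F1 t)) {-c..c}"
    unfolding Feq w_def
    by (rule polar_mean_ODE[OF C2 L c, of "cutoff_weight d k" "cutoff_weight1 d k"
          "cutoff_weight2 d k" "cutoff_weight_tan1 d k"])
      (use cos_pos DERIV_cutoff_weight DERIV_cutoff_weight1 DERIV_tan_cutoff_weight ends in
        \<open>auto simp: w_def\<close>)
  have intV: "(\<lambda>h. V t h * of_real (g h)) integrable_on {-c..c}"
    if "continuous_on {-c..c} g" for g t
    by (intro integrable_continuous_interval continuous_intros cV that)
  have trunc: "norm (integral {-pi/2..pi/2} (\<lambda>h. V t h * of_real (cos h * sin h ^ j))
      - integral {-c..c} (\<lambda>h. V t h * of_real (cos h * sin h ^ j))) \<le> M * d * pi" for t j
    unfolding cos_c[symmetric]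
  proof (rule integral_truncate_bound)
    show "norm (V t h * of_real (cos h * sin h ^ j)) \<le> M * cos h" if "h \<in> {-pi/2..pi/2}" for h
    proof -
      have "cos h \<ge> 0"
        using that by (intro cos_ge_zero) auto
      then show ?thesis
        unfolding norm_mult norm_of_real using M abs_cos_sin_power_le[of h j] by (intro mult_mono) auto
    qed
  qed (use c M in \<open>auto intro!: continuous_intros cV\<close>)
  have "norm (F t - moment u k t) \<le> \<epsilon>" for t
  proof -
    let ?I = "integral {-c..c} (\<lambda>h. V t h * of_real (cos h * sin h ^ k))"
    have "F t - ?I = integral {-c..c} (\<lambda>h. V t h * of_real (w h - cos h * sin h ^ k))"
      unfolding F_def
      by (subst Henstock_Kurzweil_Integration.integral_diff[symmetric])
        (auto intro!: intV continuous_intros cw simp del: of_real_mult simp: right_diff_distrib)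
    also have "norm \<dots> \<le> (M * (2 * d)) * (c - - c)"
    proof (rule norm_integral_le_const)
      show "norm (V t h * of_real (w h - cos h * sin h ^ k)) \<le> M * (2 * d)" if "h \<in> {-c..c}" for h
        unfolding norm_mult norm_of_real w_def using M d
        by (intro mult_mono cutoff_weight_approx cos_ge that) auto
    qed (use c in \<open>auto intro!: continuous_intros cV cw\<close>)
    also have "\<dots> \<le> (M * (2 * d)) * pi"
      using M d c by (intro mult_left_mono) auto
    finally have "norm (F t - ?I) \<le> 2 * M * d * pi" by simp
    moreover have "norm (moment u k t - ?I) \<le> M * d * pi"
      using trunc[of t k] by (simp only: moment_def V_def)
    ultimately have "norm ((F t - ?I) - (moment u k t - ?I)) \<le> 2 * M * d * pi + M * d * pi"
      by (rule norm_triangle_le_diff[OF add_mono])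
    also have "\<dots> = d * (3 * M * pi)"
      by simp
    also have "\<dots> \<le> d * Q"
      unfolding Q_def using d K M \<eta> by (intro mult_left_mono) (auto simp: q_def)
    finally show ?thesis
      using d \<epsilon> by simp
  qed
  moreover have "norm (F2 t + m * F1 t + \<alpha> * F t) \<le> \<epsilon>" for t
  proof -
    let ?I = "integral {-c..c} (\<lambda>h. V t h * of_real (cos h * sin h ^ (k - 2)))"
    define R where "R = (\<lambda>h. of_real (cutoff_weight2 d k h) + m * of_real (cutoff_weight_tan1 d k h)
        - \<alpha> * of_real (w h) - of_real (q * (cos h * sin h ^ (k - 2))))"
    have "((\<lambda>h. V t h * (of_real (cutoff_weight2 d k h) + m * of_real (cutoff_weight_tan1 d k h)))
        has_integral - (F2 t + m * F1 t)) {-c..c}"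
      using F2[of t] by (rule has_integral_eq[rotated]) (simp add: uV)
    moreover have "((\<lambda>h. V t h * of_real (w h)) has_integral F t) {-c..c}"
      unfolding F_def by (intro integrable_integral intV cw)
    moreover have "((\<lambda>h. V t h * of_real (cos h * sin h ^ (k - 2))) has_integral ?I) {-c..c}"
      by (intro integrable_integral intV continuous_intros)
    ultimately have "((\<lambda>h. V t h * (of_real (cutoff_weight2 d k h) + m * of_real (cutoff_weight_tan1 d k h))
        - \<alpha> * (V t h * of_real (w h)) - of_real q * (V t h * of_real (cos h * sin h ^ (k - 2))))
        has_integral (- (F2 t + m * F1 t) - \<alpha> * F t - of_real q * ?I)) {-c..c}"
      by (intro has_integral_diff has_integral_mult_right)
    then have RI: "((\<lambda>h. V t h * R h) has_integral (- (F2 t + m * F1 t) - \<alpha> * F t - of_real q * ?I)) {-c..c}"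
      by (rule has_integral_eq[rotated]) (simp add: R_def algebra_simps)
    have bI: "((\<lambda>h. K * (\<epsilon>' * (cos c / (cos h)\<^sup>2) + M * d / \<eta>\<^sup>2)) has_integral
        K * (\<epsilon>' * (2 * sin c) + (c - - c) *\<^sub>R (M * d / \<eta>\<^sup>2))) {-c..c}"
      using c has_integral_const_real[of "M * d / \<eta>\<^sup>2" "-c" c]
      by (intro has_integral_mult_right has_integral_add has_integral_sec_squared) auto
    have "norm (V t h * R h) \<le> K * (\<epsilon>' * (cos c / (cos h)\<^sup>2) + M * d / \<eta>\<^sup>2)" if h: "h \<in> {-c..c}" for h
    proof -
      have s: "d / (cos h)\<^sup>2 \<ge> 0"
        using d by simp
      have "norm (V t h * R h) \<le> norm (V t h) * (K * (d / (cos h)\<^sup>2))"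
        unfolding norm_mult R_def w_def q_def using d cos_ge[OF h]
        by (intro mult_left_mono defect) auto
      also have "\<dots> = K * (norm (V t h) * (d / (cos h)\<^sup>2))"
        by simp
      also have "\<dots> \<le> K * (\<epsilon>' * (d / (cos h)\<^sup>2) + M * d / \<eta>\<^sup>2)"
      proof (intro mult_left_mono K)
        show "norm (V t h) * (d / (cos h)\<^sup>2) \<le> \<epsilon>' * (d / (cos h)\<^sup>2) + M * d / \<eta>\<^sup>2"
        proof (cases "cos h \<le> \<eta>")
          case True
          have "norm (V t h) * (d / (cos h)\<^sup>2) \<le> \<epsilon>' * (d / (cos h)\<^sup>2)"
            by (intro mult_right_mono \<eta>(2) True s)
          moreover have "M * d / \<eta>\<^sup>2 \<ge> 0"
            using M d by simp
          ultimately show ?thesis by linarith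
        next
          case False
          have "norm (V t h) * (d / (cos h)\<^sup>2) \<le> M * (d / \<eta>\<^sup>2)"
            using False M \<eta>(1) d
            by (intro mult_mono divide_left_mono power_mono mult_pos_pos) (auto intro: zero_less_power)
          moreover have "\<epsilon>' * (d / (cos h)\<^sup>2) \<ge> 0"
            using \<epsilon>' s by (intro mult_nonneg_nonneg) auto
          ultimately show ?thesis by (simp only: times_divide_eq_right)
        qed
      qed
      finally show ?thesis by (simp add: cos_c)
    qed
    then have "norm (- (F2 t + m * F1 t) - \<alpha> * F t - of_real q * ?I)
        \<le> K * (\<epsilon>' * (2 * sin c) + (c - - c) *\<^sub>R (M * d / \<eta>\<^sup>2))"
      using integral_norm_bound_integral[OF has_integral_integrable[OF RI] has_integral_integrable[OF bI]]
      unfolding integral_unique[OF RI] integral_unique[OF bI] by blast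
    also have "\<dots> \<le> K * (\<epsilon>' * 2 + pi * (M * d / \<eta>\<^sup>2))"
      unfolding real_scaleR_def using K \<epsilon>' c M d
      by (intro mult_left_mono add_mono mult_right_mono) auto
    finally have *: "norm (- (F2 t + m * F1 t) - \<alpha> * F t - of_real q * ?I)
        \<le> 2 * K * \<epsilon>' + d * (K * M * pi / \<eta>\<^sup>2)"
      by (simp add: algebra_simps)
    \<comment> \<open>As the full term of order \<open>k - 2\<close> vanishes, its truncated version
      is just minus the truncation error, which is of order \<open>d\<close>.\<close>
    have "of_real q * moment u (k - 2) t = 0"
      using lower[of t] unfolding q_def by (simp only: of_real_of_nat_eq)
    then have "of_real q * ?I = - (of_real q * (moment u (k - 2) t - ?I))"
      by (simp add: right_diff_distrib)
    moreover have "norm (of_real q * (moment u (k - 2) t - ?I)) \<le> q * (M * d * pi)"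
      unfolding norm_mult norm_of_real using trunc[of t "k - 2"]
      by (intro mult_mono) (auto simp: q_def moment_def V_def)
    ultimately have **: "norm (of_real q * ?I) \<le> q * (M * d * pi)"
      by (simp only: norm_minus_cancel)
    have "F2 t + m * F1 t + \<alpha> * F t
        = - ((- (F2 t + m * F1 t) - \<alpha> * F t - of_real q * ?I) + of_real q * ?I)"
      by simp
    also have "norm \<dots> \<le> (2 * K * \<epsilon>' + d * (K * M * pi / \<eta>\<^sup>2)) + q * (M * d * pi)"
      unfolding norm_minus_cancel by (rule norm_triangle_mono[OF * **])
    also have "\<dots> = 2 * K * \<epsilon>' + d * (K * M * pi / \<eta>\<^sup>2 + q * M * pi)"
      by (simp add: algebra_simps)
    also have "\<dots> \<le> 2 * K * \<epsilon>' + d * Q"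
      unfolding Q_def using d M by (intro add_left_mono mult_left_mono) auto
    also have "\<dots> \<le> \<epsilon> / 2 + \<epsilon> / 2"
      by (intro add_mono \<epsilon>' d)
    finally show ?thesis by simp
  qed
  ultimately show ?thesis
    using F12 unfolding \<alpha>_def by blast
qed

text \<open>Strong induction removes the inhomogeneous term; \<open>a\<close> and \<open>b\<close>
  are the characteristic roots of the remaining equation.\<close>

lemma moment_eq_0:
  assumes C2: "Ck_on 2 u half_plane"
    and L: "\<forall>p\<in>half_plane. L_op m u p = 0"
    and van: "vanishes_at_boundary u"
  shows "moment u k t = 0"
proof (induction k arbitrary: t rule: less_induct)
  case (less k)
  define a b where "a = - (of_nat k + 1 :: complex)" and "b = of_nat k + 1 - m"
  have ab: "a + b = - m" "a * b = (of_nat k + 1) * (m - (of_nat k + 1))"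
    by (simp_all add: a_def b_def algebra_simps)
  \<comment> \<open>For \<open>k = 0\<close> the truncated \<open>k - 2\<close> is not below
    \<open>k\<close>, but the coefficient is 0; for every other \<open>k\<close> the induction
    hypothesis applies.\<close>
  have lower: "of_nat (k * (k - 1)) * moment u (k - 2) t = 0" for t
    using less.IH[of "k - 2"] by (cases "k = 0") auto
  show ?case
  proof (rule decaying_limit_zero[where a = a and b = b])
    show "\<exists>F F1 F2. \<forall>t. (F has_vector_derivative F1 t) (at t) \<and> (F1 has_vector_derivative F2 t) (at t)
        \<and> norm (F2 t - (a + b) * F1 t + a * b * F t) \<le> \<epsilon> \<and> norm (F t - moment u k t) \<le> \<epsilon>"
      if "\<epsilon> > 0" for \<epsilon>
      using moment_approx[OF C2 L van lower that] unfolding ab by simp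
  qed (intro moment_tendsto_0 van partial_derivs_C2(3)[OF C2])+
qed

section \<open>Functions on the half circle with vanishing sine moments\<close>

text \<open>By Weierstrass \<open>g\<close> is uniformly close to a polynomial \<open>p\<close> in
  \<open>sin h\<close>, and \<open>g\<close> is orthogonal to \<open>p (sin h)\<close> with weight
  \<open>cos h\<close>. So the integral of \<open>g\<^sup>2 * cos h\<close> is arbitrarily small,
  hence 0, and its continuous nonnegative integrand vanishes.\<close>

lemma zero_if_sine_moments_zero_real:
  fixes g :: "real \<Rightarrow> real"
  assumes cont: "continuous_on {-pi/2..pi/2} g"
    and mom: "\<And>k. integral {-pi/2..pi/2} (\<lambda>h. g h * (cos h * sin h ^ k)) = 0"
    and h: "h \<in> {-pi/2..pi/2}" "cos h > 0"
  shows "g h = 0"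
proof -
  let ?S = "{-pi/2..pi/2}"
  have cos: "cos h \<ge> 0" if "h \<in> ?S" for h
    using that by (intro cos_ge_zero) auto
  obtain M where M: "M > 0" "\<And>h. h \<in> ?S \<Longrightarrow> \<bar>g h\<bar> \<le> M"
    using compact_continuous_image[OF cont] compact_imp_bounded bounded_pos
    by (metis compact_Icc imageI real_norm_def)
  have "\<bar>integral ?S (\<lambda>h. g h * (g h * cos h))\<bar> \<le> e" if "e > 0" for e
  proof -
    \<comment> \<open>The integrand differs from one of integral 0 by at most
      \<open>M * \<delta>\<close> on an interval of length \<open>pi\<close>, which gives a total of
      \<open>e\<close>.\<close>
    define \<delta> where "\<delta> = e / (M * pi)"
    have \<delta>: "\<delta> > 0" using \<open>e > 0\<close> M by (simp add: \<delta>_def)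
    have "continuous_on {-1..1} (g \<circ> arcsin)"
    proof (rule continuous_on_compose[OF continuous_on_arcsin'])
      show "continuous_on (arcsin ` {-1..1}) g"
        using arcsin_bounded by (intro continuous_on_subset[OF cont]) auto
    qed
    then obtain p where p: "real_polynomial_function p"
        "\<And>s. s \<in> {-1..1} \<Longrightarrow> \<bar>(g \<circ> arcsin) s - p s\<bar> < \<delta>"
      using Stone_Weierstrass_real_polynomial_function[OF compact_Icc _ \<delta>] by blast
    obtain a n where a: "p = (\<lambda>x. \<Sum>i\<le>n. a i * x ^ i)"
      using p(1) real_polynomial_function_iff_sum by blast
    have int: "(\<lambda>h. g h * (cos h * sin h ^ k)) integrable_on ?S" for k
      by (intro integrable_continuous_interval continuous_intros cont)
    have "((\<lambda>h. \<Sum>i\<le>n. a i * (g h * (cos h * sin h ^ i))) has_integral (\<Sum>i\<le>n. a i * 0)) ?S"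
      using mom int by (intro has_integral_sum has_integral_mult_right) (auto simp: has_integral_iff)
    moreover have "(\<Sum>i\<le>n. a i * (g h * (cos h * sin h ^ i))) = g h * (p (sin h) * cos h)" for h
      by (simp add: a sum_distrib_left sum_distrib_right mult_ac)
    ultimately have pI: "((\<lambda>h. g h * (p (sin h) * cos h)) has_integral 0) ?S"
      by simp
    have gI: "((\<lambda>h. g h * (g h * cos h)) has_integral integral ?S (\<lambda>h. g h * (g h * cos h))) ?S"
      by (intro integrable_integral integrable_continuous_interval continuous_intros cont)
    have "norm (integral ?S (\<lambda>h. g h * (g h * cos h)) - 0)
        \<le> M * \<delta> * Henstock_Kurzweil_Integration.content ?S"
    proof (rule has_integral_bound_real[OF _ finite.emptyI has_integral_diff[OF gI pI]])
      fix h assume "h \<in> ?S - {}"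
      then have h: "h \<in> ?S" by simp
      have "\<bar>g h - p (sin h)\<bar> \<le> \<delta>"
        using p(2)[of "sin h"] arcsin_sin[of h] h by auto
      then have "\<bar>g h\<bar> * \<bar>(g h - p (sin h)) * cos h\<bar> \<le> M * (\<delta> * 1)"
        unfolding abs_mult using M h \<delta> by (intro mult_mono) auto
      then show "norm (g h * (g h * cos h) - g h * (p (sin h) * cos h)) \<le> M * \<delta>"
        by (simp add: abs_mult[symmetric] algebra_simps)
    qed (use M \<delta> in auto)
    also have "\<dots> = e"
      using M by (simp add: \<delta>_def)
    finally show ?thesis by simp
  qed
  then have "\<bar>integral ?S (\<lambda>h. g h * (g h * cos h))\<bar> \<le> 0"
    by (rule field_le_epsilon) simp
  then have "integral ?S (\<lambda>h. g h * (g h * cos h)) = 0"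
    by simp
  moreover have "0 \<le> g h * (g h * cos h)" if "h \<in> ?S" for h
    using cos[OF that] by (simp flip: mult.assoc)
  moreover have "continuous_on ?S (\<lambda>h. g h * (g h * cos h))"
    by (intro continuous_intros cont)
  ultimately have "\<forall>h\<in>?S. g h * (g h * cos h) = 0"
    using integral_eq_0_iff[of "-pi/2" "pi/2" "\<lambda>h. g h * (g h * cos h)"] by simp
  then show ?thesis
    using h by auto
qed

text \<open>The weights are real, so the moments of the real and imaginary parts vanish
  separately.\<close>

lemma zero_if_sine_moments_zero:
  fixes g :: "real \<Rightarrow> complex"
  assumes cont: "continuous_on {-pi/2..pi/2} g"
    and mom: "\<And>k. integral {-pi/2..pi/2} (\<lambda>h. g h * of_real (cos h * sin h ^ k)) = 0"
    and h: "h \<in> {-pi/2..pi/2}" "cos h > 0"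
  shows "g h = 0"
proof -
  have int: "((\<lambda>h. g h * of_real (cos h * sin h ^ k)) has_integral 0) {-pi/2..pi/2}" for k
    unfolding has_integral_iff
    by (intro conjI mom integrable_continuous_interval continuous_intros cont)
  have "Re (g h) = 0"
  proof (rule zero_if_sine_moments_zero_real[OF _ _ h])
    show "continuous_on {-pi/2..pi/2} (\<lambda>h. Re (g h))"
      by (intro continuous_intros cont)
    show "integral {-pi/2..pi/2} (\<lambda>h. Re (g h) * (cos h * sin h ^ k)) = 0" for k
      using has_integral_linear[OF int bounded_linear_Re, of k]
      by (intro integral_unique) (simp add: o_def del: of_real_mult)
  qed
  moreover have "Im (g h) = 0"
  proof (rule zero_if_sine_moments_zero_real[OF _ _ h])
    show "continuous_on {-pi/2..pi/2} (\<lambda>h. Im (g h))"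
      by (intro continuous_intros cont)
    show "integral {-pi/2..pi/2} (\<lambda>h. Im (g h) * (cos h * sin h ^ k)) = 0" for k
      using has_integral_linear[OF int bounded_linear_Im, of k]
      by (intro integral_unique) (simp add: o_def del: of_real_mult)
  qed
  ultimately show ?thesis
    by (simp add: complex_eq_iff)
qed

lemma log_polar_surj:
  assumes "p \<in> half_plane"
  obtains t h where "h \<in> {-pi/2..pi/2}" "cos h > 0" "p = log_polar t h"
proof -
  obtain x y where p: "p = (x, y)" "x > 0"
    using assms by (auto simp: half_plane_def)
  define h where "h = arctan (y / x)"
  have h: "- (pi / 2) < h" "h < pi / 2"
    using arctan_bounded[of "y / x"] by (auto simp: h_def)
  then have cos: "cos h > 0"
    by (intro cos_gt_zero_pi)
  have "tan h = y / x"
    by (simp add: h_def tan_arctan)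
  then have "sin h = y / x * cos h"
    using cos by (simp add: tan_def field_simps)
  then have "p = log_polar (ln (x / cos h)) h"
    using p cos by (simp add: log_polar_def)
  then show ?thesis
    using h cos by (intro that[of h "ln (x / cos h)"]) auto
qed

theorem proposition5p2:
  fixes m :: complex and u :: "real \<times> real \<Rightarrow> complex"
  assumes "Ck_on 2 u half_plane"
    and "\<forall>p\<in>half_plane. L_op m u p = 0"
    and "vanishes_at_boundary u"
  shows "\<forall>p\<in>half_plane. u p = 0"
proof
  fix p assume p: "p \<in> half_plane"
  then obtain t h where h: "h \<in> {-pi/2..pi/2}" "cos h > 0" and th: "p = log_polar t h"
    by (rule log_polar_surj)
  \<comment> \<open>The radius is fixed here, and all moments on that half circle vanish.\<close>
  have "zero_ext u (log_polar t h) = 0"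
  proof (rule zero_if_sine_moments_zero[OF _ _ h])
    show "continuous_on {-pi/2..pi/2} (\<lambda>h. zero_ext u (log_polar t h))"
      by (intro continuous_zero_ext_log_polar partial_derivs_C2(3) assms)
    show "integral {-pi/2..pi/2} (\<lambda>h. zero_ext u (log_polar t h) * of_real (cos h * sin h ^ k)) = 0"
      for k
      using moment_eq_0[OF assms, of k t] by (simp only: moment_def)
  qed
  then show "u p = 0"
    using p th by (simp add: zero_ext_def)
qed

end
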